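(* Let $W\subset\mathbb{R}^n$ be an open neighbourhood of $0$, let $f,g_1,\dots,g_m$ be smooth vector fields on $W$ and $h_1,\dots,h_p$ smooth functions on $W$ with $h_j(0)=0$, and consider the control system $\dot x=f(x)+\sum_{i=1}^m g_i(x)u_i$, $y_\ell=h_\ell(x)$, $\ell=1,\dots,p$. Define co-distributions $\mathcal{H}^0_*:=\mathrm{Span}\{\mathrm{d}h_1,\dots,\mathrm{d}h_p\}$ and $\mathcal{H}^{k+1}_*:=\mathcal{H}^k_*+L_f(\mathcal{H}^k_* )+\sum_{i=1}^m L_{g_i}(\mathcal{H}^k_* )$ for $k\ge 0$. Assume $0$ is a regular point and that $\mathcal{H}^{k^*+1}_*=\mathcal{H}^{k^*}_*$. Then $\mathcal{H}^{k^*}_*$ is the smallest exact co-distribution that contains $\mathcal{H}^0_*$ and is invariant under $f$ and all $g_i$, and replacing $\mathcal{H}^0_*$ by $\mathcal{H}^{k^*}_*$ (that is, replacing the output functions $h_1,\dots,h_p$ by smooth functions $z_1,\dots,z_s$ with $z_j(0)=0$ whose differentials span $\mathcal{H}^{k^*}_*$) yields, locally around $0$, an exact OR-system, the (smallest) extended OR-system of the original system.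
   Context: Regular point: all co-distributions involved (here every $\mathcal{H}^k_*$) have constant dimension near $0$; all statements are local around $0$. Spans are over smooth functions, and $L_f$ denotes the Lie derivative, with $L_f(\mathcal{H}):=\mathrm{Span}\{L_f\omega:\omega\in\mathcal{H}\}$. A co-distribution is exact if it is spanned by differentials $\mathrm{d}z_1,\dots,\mathrm{d}z_s$ of finitely many smooth functions; with $Z=(z_1,\dots,z_s)^{\mathrm T}$ it is $f$-invariant if $L_f(\mathrm{d}Z)=\Xi\,\mathrm{d}Z$ for some smooth $s\times s$-matrix-valued function $\Xi$. For output functions $Z$ and a smooth map $\psi$ from a neighbourhood of $0$ in $\mathbb{R}^s$ to $W$, the OR-system (observer-based realization) is $\dot z=L_fZ(\psi(z))+\sum_{i=1}^m L_{g_i}Z(\psi(z))u_i$; "yields an exact OR-system" means that there exist $\psi$ and a neighbourhood $U$ of $0$ such that $L_fZ(\psi(Z(x)))=L_fZ(x)$ and $L_{g_i}Z(\psi(Z(x)))=L_{g_i}Z(x)$ for all $x\in U$ and all $i$. The extended OR-system is the OR-system obtained from the smallest $f$- and $g_i$-invariant exact co-distribution containing $\mathrm{Span}\{\mathrm{d}h_1,\dots,\mathrm{d}h_p\}$. *)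

theory Defs
  imports "HOL-Analysis.Analysis"
begin

text \<open>\<open>Ck_on k f U\<close> is \<open>k\<close>-fold continuous differentiability; it is only meant for open \<open>U\<close>.\<close>

fun Ck_on :: "nat \<Rightarrow> ('a::real_normed_vector \<Rightarrow> 'b::real_normed_vector) \<Rightarrow> 'a set \<Rightarrow> bool" where
  "Ck_on 0 f U \<longleftrightarrow> continuous_on U f"
| "Ck_on (Suc k) f U \<longleftrightarrow>
     (\<forall>x\<in>U. f differentiable (at x)) \<and> (\<forall>v. Ck_on k (\<lambda>x. frechet_derivative f (at x) v) U)"

definition smooth_on :: "'a::real_normed_vector set \<Rightarrow> ('a \<Rightarrow> 'b::real_normed_vector) \<Rightarrow> bool" where
  "smooth_on U f \<longleftrightarrow> (\<forall>k. Ck_on k f U)"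

text \<open>
  A one-form \<open>\<omega>\<close> is written as a row vector field: \<open>\<omega> x $ i\<close> is the coefficient of \<open>dx\<^sub>i\<close>.
  Functions, vector fields and forms on an open set \<open>U\<close> are total functions of which only the
  restriction to \<open>U\<close> matters.
\<close>

type_synonym 'n field = "real ^ 'n \<Rightarrow> real ^ 'n"

definition differential :: "(real ^ 'n \<Rightarrow> real) \<Rightarrow> 'n field" where
  "differential \<phi> x = (\<chi> i. frechet_derivative \<phi> (at x) (axis i 1))"

definition lie_fun :: "'n field \<Rightarrow> (real ^ 'n \<Rightarrow> 'b::real_normed_vector) \<Rightarrow> real ^ 'n \<Rightarrow> 'b" where
  "lie_fun v \<phi> x = frechet_derivative \<phi> (at x) (v x)"

text \<open>
  In coordinates:
  \<open>(L\<^sub>v \<omega>)\<^sub>j = \<Sum>\<^sub>i v\<^sub>i (\<partial>\<omega>\<^sub>j / \<partial>x\<^sub>i) + \<Sum>\<^sub>i \<omega>\<^sub>i (\<partial>v\<^sub>i / \<partial>x\<^sub>j)\<close>.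
\<close>

definition lie_form :: "'n::finite field \<Rightarrow> 'n field \<Rightarrow> 'n field" where
  "lie_form v \<omega> x =
     frechet_derivative \<omega> (at x) (v x) + \<omega> x v* matrix (frechet_derivative v (at x))"

text \<open>
  Co-distributions on an open set \<open>U\<close> are modules of one-forms over the smooth functions on \<open>U\<close>.
  Since \<open>span_on U S\<close> is closed under changing a form outside \<open>U\<close>, equality and inclusion of such
  sets of forms are equality and inclusion of modules of forms on \<open>U\<close>.
\<close>

definition span_on :: "(real ^ 'n) set \<Rightarrow> 'n::finite field set \<Rightarrow> 'n field set" where
  "span_on U S = {\<omega>. \<exists>(N::nat) c \<alpha>.
      (\<forall>i<N. smooth_on U (c i :: real ^ 'n \<Rightarrow> real) \<and> \<alpha> i \<in> S) \<and>
      (\<forall>x\<in>U. \<omega> x = (\<Sum>i<N. c i x *\<^sub>R \<alpha> i x))}"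

definition lie_codist :: "(real ^ 'n) set \<Rightarrow> 'n::finite field \<Rightarrow> 'n field set \<Rightarrow> 'n field set" where
  "lie_codist U v H = span_on U (lie_form v ` H)"

fun codist ::
  "(real ^ 'n) set \<Rightarrow> 'n::finite field \<Rightarrow> nat \<Rightarrow> (nat \<Rightarrow> 'n field) \<Rightarrow>
   nat \<Rightarrow> (nat \<Rightarrow> real ^ 'n \<Rightarrow> real) \<Rightarrow> nat \<Rightarrow> 'n field set" where
  "codist U f m g p h 0 = span_on U ((\<lambda>l. differential (h l)) ` {1..p})"
| "codist U f m g p h (Suc k) =
     {\<lambda>x. \<alpha> x + \<beta> x + (\<Sum>i\<in>{1..m}. \<gamma> i x) | \<alpha> \<beta> \<gamma>.
        \<alpha> \<in> codist U f m g p h k \<and>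
        \<beta> \<in> lie_codist U f (codist U f m g p h k) \<and>
        (\<forall>i\<in>{1..m}. \<gamma> i \<in> lie_codist U (g i) (codist U f m g p h k))}"

definition constant_dim_near_0 :: "'n::finite field set \<Rightarrow> bool" where
  "constant_dim_near_0 H \<longleftrightarrow> (\<exists>d. \<forall>\<^sub>F x in nhds 0. dim {\<omega> x | \<omega>. \<omega> \<in> H} = d)"

definition spanned_by_differentials ::
  "(real ^ 'n) set \<Rightarrow> nat \<Rightarrow> (nat \<Rightarrow> real ^ 'n \<Rightarrow> real) \<Rightarrow> 'n::finite field set \<Rightarrow> bool" where
  "spanned_by_differentials U s z H \<longleftrightarrow>
     (\<forall>j\<in>{1..s}. smooth_on U (z j)) \<and> H = span_on U ((\<lambda>j. differential (z j)) ` {1..s})"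

definition exact_codist :: "(real ^ 'n) set \<Rightarrow> 'n::finite field set \<Rightarrow> bool" where
  "exact_codist U H \<longleftrightarrow> (\<exists>s z. spanned_by_differentials U s z H)"

definition invariant_codist ::
  "(real ^ 'n) set \<Rightarrow> 'n::finite field \<Rightarrow> 'n field set \<Rightarrow> bool" where
  "invariant_codist U v H \<longleftrightarrow> (\<exists>s z. spanned_by_differentials U s z H \<and>
     (\<exists>\<Xi> :: nat \<Rightarrow> nat \<Rightarrow> real ^ 'n \<Rightarrow> real.
        (\<forall>i\<in>{1..s}. \<forall>j\<in>{1..s}. smooth_on U (\<Xi> i j)) \<and>
        (\<forall>i\<in>{1..s}. \<forall>x\<in>U. lie_form v (differential (z i)) x =
           (\<Sum>j\<in>{1..s}. \<Xi> i j x *\<^sub>R differential (z j) x))))"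

definition exact_invariant_containing ::
  "(real ^ 'n) set \<Rightarrow> 'n::finite field \<Rightarrow> nat \<Rightarrow> (nat \<Rightarrow> 'n field) \<Rightarrow> 'n field set \<Rightarrow> 'n field set \<Rightarrow> bool" where
  "exact_invariant_containing U f m g H0 K \<longleftrightarrow>
     exact_codist U K \<and> H0 \<subseteq> K \<and> invariant_codist U f K \<and> (\<forall>i\<in>{1..m}. invariant_codist U (g i) K)"

definition smallest_exact_invariant_containing ::
  "(real ^ 'n) set \<Rightarrow> 'n::finite field \<Rightarrow> nat \<Rightarrow> (nat \<Rightarrow> 'n field) \<Rightarrow> 'n field set \<Rightarrow> 'n field set \<Rightarrow> bool" where
  "smallest_exact_invariant_containing U f m g H0 K \<longleftrightarrow>
     exact_invariant_containing U f m g H0 K \<and>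
     (\<forall>K'. exact_invariant_containing U f m g H0 K' \<longrightarrow> K \<subseteq> K')"

text \<open>Output maps \<open>Z = (z\<^sub>1, \<dots>, z\<^sub>s)\<^sup>T\<close> with \<open>Z 0 = 0\<close> whose differentials span \<open>H\<close>; here \<open>s = CARD('s)\<close>.\<close>

definition output_map ::
  "(real ^ 'n) set \<Rightarrow> 'n::finite field set \<Rightarrow> (real ^ 'n \<Rightarrow> real ^ 's::finite) \<Rightarrow> bool" where
  "output_map U H Z \<longleftrightarrow> smooth_on U Z \<and> Z 0 = 0 \<and>
     H = span_on U (range (\<lambda>j. differential (\<lambda>x. Z x $ j)))"

text \<open>The right-hand side of the OR-system, as a function of the state \<open>z\<close> and the input \<open>u\<close>.\<close>

definition OR_system ::
  "'n field \<Rightarrow> nat \<Rightarrow> (nat \<Rightarrow> 'n field) \<Rightarrow> (real ^ 'n \<Rightarrow> real ^ 's) \<Rightarrow> (real ^ 's \<Rightarrow> real ^ 'n) \<Rightarrow>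
   real ^ 's::finite \<Rightarrow> (nat \<Rightarrow> real) \<Rightarrow> real ^ 's" where
  "OR_system f m g Z \<psi> z u =
     lie_fun f Z (\<psi> z) + (\<Sum>i\<in>{1..m}. u i *\<^sub>R lie_fun (g i) Z (\<psi> z))"

text \<open>\<open>U\<close> is the domain of \<open>Z\<close>, hence the codomain of \<open>\<psi>\<close>.\<close>

definition exact_OR_realization ::
  "(real ^ 'n) set \<Rightarrow> 'n field \<Rightarrow> nat \<Rightarrow> (nat \<Rightarrow> 'n field) \<Rightarrow> (real ^ 'n \<Rightarrow> real ^ 's) \<Rightarrow>
   (real ^ 's::finite) set \<Rightarrow> (real ^ 's \<Rightarrow> real ^ 'n) \<Rightarrow> bool" where
  "exact_OR_realization U f m g Z V \<psi> \<longleftrightarrow>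
     open V \<and> 0 \<in> V \<and> smooth_on V \<psi> \<and> \<psi> ` V \<subseteq> U \<and>
     (\<exists>N. open N \<and> 0 \<in> N \<and> N \<subseteq> U \<and>
        (\<forall>x\<in>N. Z x \<in> V \<and> lie_fun f Z (\<psi> (Z x)) = lie_fun f Z x \<and>
           (\<forall>i\<in>{1..m}. lie_fun (g i) Z (\<psi> (Z x)) = lie_fun (g i) Z x)))"

text \<open>
  \<open>\<Phi>\<close> (with state domain \<open>V\<close>) is an extended OR-system: an exact OR-system obtained from the
  smallest exact co-distribution containing \<open>H0\<close> that is invariant under all the fields.
\<close>

definition extended_OR_system ::
  "(real ^ 'n) set \<Rightarrow> 'n::finite field \<Rightarrow> nat \<Rightarrow> (nat \<Rightarrow> 'n field) \<Rightarrow> nat \<Rightarrow> (nat \<Rightarrow> real ^ 'n \<Rightarrow> real) \<Rightarrow>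
   (real ^ 's::finite) set \<Rightarrow> (real ^ 's \<Rightarrow> (nat \<Rightarrow> real) \<Rightarrow> real ^ 's) \<Rightarrow> bool" where
  "extended_OR_system U f m g p h V \<Phi> \<longleftrightarrow> (\<exists>H Z \<psi>.
     smallest_exact_invariant_containing U f m g (codist U f m g p h 0) H \<and>
     output_map U H Z \<and> exact_OR_realization U f m g Z V \<psi> \<and>
     (\<forall>z\<in>V. \<Phi> z = OR_system f m g Z \<psi> z))"

end

(* Since L_v(d phi) = d(L_v phi), the co-distribution H^k is spanned by the differentials of the
   iterated Lie derivatives of length at most k of the outputs; it is therefore exact by
   construction, and minimality is an induction on k.  The stationarity of the sequence is invariance.

   For the OR-system, let K be the kernel of DZ(0), P a linear left inverse of DZ(0) on the orthogonal
   complement of K, and L = id - P DZ(0), a projection onto K.  The map F = P Z + L has derivative id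
   at 0; with its local inverse G put psi = G P.  The curve G(P Z(x) + t L x) runs from psi(Z(x)) to x.
   Along it P DZ annihilates the velocity, and by constancy of the rank so does DZ; hence every
   function whose differential lies in the co-distribution is constant along the curve, in particular
   the components of L_f Z and L_{g_i} Z, by invariance. *)
theory Submission
  imports Defs
begin

section \<open>Smooth functions\<close>

text \<open>The map Z may have redundant components, so near 0 its image need not be open in R^s,
  while \<psi> has to be smooth on an open subset of R^s; composing with P discards the redundant
  directions. Locally, \<psi>(Z(x)) is the point q with P(Z(q)) = P(Z(x)) and L q = 0: the place
  where the level set of P Z through x meets the linear slice ker L. Since \<psi> is built from Z
  alone, before any function to be kept constant is named, one \<psi> and one neighbourhood serve f
  and all g_i.

  Co-distributions are modules over the smooth functions on a chosen open set, so each statement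
  depends on that set. The iterated Lie derivatives do not: the same finite set of functions
  generates H^k over every open subset of W. Stationarity and pointwise dimension therefore pass to
  smaller neighbourhoods by restricting coefficients, without any gluing.\<close>

lemma Ck_on_cong:
  assumes "open U" "\<And>x. x \<in> U \<Longrightarrow> f x = g x"
  shows "Ck_on k f U \<longleftrightarrow> Ck_on k g U"
  using assms(2)
proof (induction k arbitrary: f g)
  case 0
  then show ?case by (auto cong: continuous_on_cong)
next
  case (Suc k)
  have one: "Ck_on (Suc k) b U" if ab: "\<And>x. x \<in> U \<Longrightarrow> a x = b x" and a: "Ck_on (Suc k) a U" 
    for a b :: "'a \<Rightarrow> 'b"
  proof -
    have d: "frechet_derivative a (at x) = frechet_derivative b (at x)" if "x \<in> U" for x
      using frechet_derivative_transform_within_open[OF _ assms(1) that ab] a that by simp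
    have "b differentiable (at x)" if "x \<in> U" for x
      using a that ab assms(1) unfolding Ck_on.simps differentiable_def
      by (meson has_derivative_transform_within_open)
    moreover have "Ck_on k (\<lambda>x. frechet_derivative b (at x) v) U" for v
      using a Suc.IH[of "\<lambda>x. frechet_derivative a (at x) v" "\<lambda>x. frechet_derivative b (at x) v"] d
      by simp
    ultimately show ?thesis by simp
  qed
  show ?case
    using one[of f g] one[of g f] Suc.prems by fastforce
qed

text \<open>\<open>Ck_on\<close> is phrased with the chosen \<open>frechet_derivative\<close>;
  uniqueness of derivatives lets an explicit formula \<open>f'\<close> take its place, so that the
  differentiation rules can be used directly.\<close>

lemma Ck_on_SucI:
  assumes "open U" "\<And>x. x \<in> U \<Longrightarrow> (f has_derivative f' x) (at x)"
    and "\<And>v. Ck_on k (\<lambda>x. f' x v) U"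
  shows "Ck_on (Suc k) f U"
proof -
  have "frechet_derivative f (at x) = f' x" if "x \<in> U" for x
    using frechet_derivative_at[OF assms(2)[OF that]] by simp
  then have "Ck_on k (\<lambda>x. frechet_derivative f (at x) v) U" for v
    using assms(3) Ck_on_cong[OF assms(1), of "\<lambda>x. frechet_derivative f (at x) v" "\<lambda>x. f' x v" k] by simp
  then show ?thesis
    using assms(2) by (auto simp: differentiable_def)
qed

lemma Ck_on_SucD: "Ck_on (Suc k) f U \<Longrightarrow> Ck_on k f U"
proof (induction k arbitrary: f)
  case 0
  then show ?case
    by (auto intro!: continuous_at_imp_continuous_on differentiable_imp_continuous_within)
next
  case (Suc k)
  then show ?case by (metis Ck_on.simps(2))
qed

lemma Ck_on_derivative:
  assumes "Ck_on (Suc k) f U" "x \<in> U"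
  shows "(f has_derivative frechet_derivative f (at x)) (at x)"
  using assms frechet_derivative_works by auto

lemma Ck_on_subset: "Ck_on k f U \<Longrightarrow> V \<subseteq> U \<Longrightarrow> Ck_on k f V"
  by (induction k arbitrary: f) (auto intro: continuous_on_subset)

lemma Ck_on_const: "open U \<Longrightarrow> Ck_on k (\<lambda>x. c) U"
proof (induction k arbitrary: c)
  case (Suc k)
  show ?case by (rule Ck_on_SucI[OF Suc.prems, where f'="\<lambda>_ _. 0"]) (use Suc in auto)
qed auto

lemma Ck_on_bounded_linear:
  assumes "open U" "bounded_linear L"
  shows "Ck_on k f U \<Longrightarrow> Ck_on k (\<lambda>x. L (f x)) U"
proof (induction k arbitrary: f)
  case 0
  then show ?case using bounded_linear.continuous_on[OF assms(2)] by auto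
next
  case (Suc k)
  show ?case
    by (rule Ck_on_SucI[OF assms(1), where f'="\<lambda>x v. L (frechet_derivative f (at x) v)"])
      (use Suc Ck_on_derivative[OF Suc.prems] in \<open>auto intro!: bounded_linear.has_derivative[OF assms(2)]\<close>)
qed

lemma Ck_on_ident: "open U \<Longrightarrow> Ck_on k (\<lambda>x. x) U"
  by (cases k) (auto intro!: Ck_on_SucI[where f'="\<lambda>_ v. v"] Ck_on_const simp del: Ck_on.simps(2))

lemma Ck_on_add:
  assumes "open U"
  shows "Ck_on k f U \<Longrightarrow> Ck_on k g U \<Longrightarrow> Ck_on k (\<lambda>x. f x + g x) U"
proof (induction k arbitrary: f g)
  case 0
  then show ?case by (auto intro: continuous_on_add)
next
  case (Suc k)
  show ?case
    by (rule Ck_on_SucI[OF assms(1), 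
          where f'="\<lambda>x v. frechet_derivative f (at x) v + frechet_derivative g (at x) v"])
      (use Suc Ck_on_derivative[OF Suc.prems(1)] Ck_on_derivative[OF Suc.prems(2)] in 
        \<open>auto intro!: has_derivative_add\<close>)
qed

lemma Ck_on_sum:
  assumes "open U" "\<And>i. i \<in> I \<Longrightarrow> Ck_on k (f i) U"
  shows "Ck_on k (\<lambda>x. \<Sum>i\<in>I. f i x) U"
  using assms(2)
  by (induction I rule: infinite_finite_induct) (auto intro: Ck_on_const Ck_on_add assms(1))

text \<open>The product rule gives two products in each of which one factor has lost one order;
  \<open>Ck_on_SucD\<close> lowers the other factor, and the induction hypothesis applies.\<close>

lemma Ck_on_bilinear:
  assumes "open U" "bounded_bilinear B"
  shows "Ck_on k f U \<Longrightarrow> Ck_on k g U \<Longrightarrow> Ck_on k (\<lambda>x. B (f x) (g x)) U"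
proof (induction k arbitrary: f g)
  case 0
  then show ?case by (auto intro: bounded_bilinear.continuous_on[OF assms(2)])
next
  case (Suc k)
  have "Ck_on k (\<lambda>x. B (f x) (frechet_derivative g (at x) v) + B (frechet_derivative f (at x) v) (g x)) U" for v
    using Suc.prems Suc.prems[THEN Ck_on_SucD] by (intro Ck_on_add assms Suc.IH) auto
  then show ?case
    by (intro Ck_on_SucI[OF assms(1), where f'="\<lambda>x v. B (f x) (frechet_derivative g (at x) v) + B (frechet_derivative f (at x) v) (g x)"])
      (use Ck_on_derivative[OF Suc.prems(1)] Ck_on_derivative[OF Suc.prems(2)] in 
        \<open>auto intro!: bounded_bilinear.FDERIV[OF assms(2)]\<close>)
qed

lemmas Ck_on_scaleR = Ck_on_bilinear[OF _ bounded_bilinear_scaleR]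
lemmas Ck_on_mult = Ck_on_bilinear[OF _ bounded_bilinear_mult]

lemma Ck_on_prod:
  fixes f :: "'i \<Rightarrow> 'a::real_normed_vector \<Rightarrow> real"
  assumes "open U" "\<And>i. i \<in> I \<Longrightarrow> Ck_on k (f i) U"
  shows "Ck_on k (\<lambda>x. \<Prod>i\<in>I. f i x) U"
  using assms(2)
  by (induction I rule: infinite_finite_induct) (auto intro: Ck_on_const Ck_on_mult assms(1))

text \<open>The derivative of 1/f contains 1/f again, but is needed only to order k, where the
  induction hypothesis supplies it.\<close>

lemma Ck_on_inverse:
  fixes f :: "'a::real_normed_vector \<Rightarrow> real"
  assumes "open U" "\<And>x. x \<in> U \<Longrightarrow> f x \<noteq> 0"
  shows "Ck_on k f U \<Longrightarrow> Ck_on k (\<lambda>x. inverse (f x)) U"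
proof (induction k)
  case 0
  then show ?case using assms by (auto intro!: continuous_on_inverse)
next
  case (Suc k)
  have "Ck_on k (\<lambda>x. - (inverse (f x) * frechet_derivative f (at x) v * inverse (f x))) U" for v
    using Suc.prems Suc.IH[OF Ck_on_SucD[OF Suc.prems]]
    by (intro Ck_on_bounded_linear[OF assms(1) bounded_linear_minus[OF bounded_linear_ident]] Ck_on_mult assms(1)) auto
  then show ?case
    by (intro Ck_on_SucI[OF assms(1), where f'="\<lambda>x v. - (inverse (f x) * frechet_derivative f (at x) v * inverse (f x))"])
      (use Ck_on_derivative[OF Suc.prems] assms(2) in \<open>auto intro!: has_derivative_inverse\<close>)
qed

section \<open>Coordinates and composition\<close>

text \<open>\<open>Ck_on\<close> controls derivatives in fixed directions only. A direction that
  varies with the point is reduced by this expansion to finitely many fixed ones, with its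
  coordinates as coefficients.\<close>

lemma linear_axis_expansion:
  fixes L :: "real ^ 'n::finite \<Rightarrow> 'b::real_vector"
  assumes "linear L"
  shows "L v = (\<Sum>i\<in>UNIV. (v $ i) *\<^sub>R L (axis i 1))"
proof -
  have "L v = L (\<Sum>i\<in>UNIV. (v $ i) *\<^sub>R axis i 1)"
    using basis_expansion[of v] by (simp add: scalar_mult_eq_scaleR)
  then show ?thesis
    by (simp add: linear_sum[OF assms] linear_cmul[OF assms])
qed

text \<open>The chain rule differentiates g in the moving direction Df(x)v, which \<open>?E\<close>
  rewrites over the fixed axes; hence the target \<open>real ^ 'n\<close> of the inner map. The
  induction leaves g arbitrary because its hypothesis is applied to directional derivatives of
  g.\<close>

lemma Ck_on_compose:
  fixes f :: "'a::real_normed_vector \<Rightarrow> real ^ 'n::finite"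
  assumes "open U" "open V" "f ` U \<subseteq> V"
  shows "Ck_on k f U \<Longrightarrow> Ck_on k g V \<Longrightarrow> Ck_on k (\<lambda>x. g (f x)) U"
proof (induction k arbitrary: g)
  case 0
  then show ?case using assms(3) by (auto intro: continuous_on_compose2)
next
  case (Suc k)
  let ?D = "\<lambda>x v. frechet_derivative g (at (f x)) (frechet_derivative f (at x) v)"
  let ?E = "\<lambda>x v. \<Sum>i\<in>UNIV. (frechet_derivative f (at x) v $ i) *\<^sub>R frechet_derivative g (at (f x)) (axis i 1)"
  have der: "((\<lambda>x. g (f x)) has_derivative ?D x) (at x)" if "x \<in> U" for x
    using has_derivative_compose[OF Ck_on_derivative[OF Suc.prems(1) that]
        Ck_on_derivative[OF Suc.prems(2)]] that assms(3) by blast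
  have "?D x v = ?E x v" if "x \<in> U" for x v
    using Ck_on_derivative[OF Suc.prems(2), of "f x"] that assms(3) 
    by (intro linear_axis_expansion) (auto dest: has_derivative_linear)
  moreover have "Ck_on k (\<lambda>x. ?E x v) U" for v
    using Suc.prems Ck_on_SucD[OF Suc.prems(1)]
    by (intro Ck_on_sum Ck_on_scaleR assms Suc.IH
        Ck_on_bounded_linear[OF _ bounded_linear_vec_nth]) auto
  ultimately have "Ck_on k (\<lambda>x. ?D x v) U" for v
    using Ck_on_cong[OF assms(1), of "\<lambda>x. ?D x v" "\<lambda>x. ?E x v" k] by simp
  with der show ?case by (intro Ck_on_SucI[OF assms(1)])
qed

lemma Ck_on_vec:
  fixes f :: "'a::real_normed_vector \<Rightarrow> real ^ 'n::finite"
  assumes "open U" "\<And>i. Ck_on k (\<lambda>x. f x $ i) U"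
  shows "Ck_on k f U"
proof -
  have "Ck_on k (\<lambda>x. \<Sum>i\<in>UNIV. (f x $ i) *\<^sub>R (axis i 1 :: real ^ 'n)) U"
    by (intro Ck_on_sum Ck_on_scaleR Ck_on_const assms)
  moreover have "(\<Sum>i\<in>UNIV. (f x $ i) *\<^sub>R (axis i 1 :: real ^ 'n)) = f x" for x
    using basis_expansion[of "f x"] by (simp add: scalar_mult_eq_scaleR)
  ultimately show ?thesis by simp
qed

section \<open>Closure properties of smooth maps\<close>

lemma smooth_on_cong:
  "open U \<Longrightarrow> (\<And>x. x \<in> U \<Longrightarrow> f x = g x) \<Longrightarrow> smooth_on U f \<longleftrightarrow> smooth_on U g"
  unfolding smooth_on_def using Ck_on_cong by blast

lemma smooth_on_transform:
  "open U \<Longrightarrow> smooth_on U g \<Longrightarrow> (\<And>x. x \<in> U \<Longrightarrow> f x = g x) \<Longrightarrow> smooth_on U f"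
  by (subst smooth_on_cong[of U f g]) auto

lemma smooth_on_subset: "smooth_on U f \<Longrightarrow> V \<subseteq> U \<Longrightarrow> smooth_on V f"
  unfolding smooth_on_def using Ck_on_subset by blast

lemma smooth_on_has_derivative:
  "smooth_on U f \<Longrightarrow> x \<in> U \<Longrightarrow> (f has_derivative frechet_derivative f (at x)) (at x)"
  unfolding smooth_on_def using Ck_on_derivative by blast

lemma smooth_on_frechet_derivative:
  "smooth_on U f \<Longrightarrow> smooth_on U (\<lambda>x. frechet_derivative f (at x) v)"
  unfolding smooth_on_def using Ck_on.simps(2) by blast

lemma smooth_on_continuous_on: "smooth_on U f \<Longrightarrow> continuous_on U f"
  unfolding smooth_on_def using Ck_on.simps(1) by blast

lemma smooth_on_const: "open U \<Longrightarrow> smooth_on U (\<lambda>x. c)"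
  and smooth_on_ident: "open U \<Longrightarrow> smooth_on U (\<lambda>x. x)"
  and smooth_on_add: "open U \<Longrightarrow> smooth_on U f \<Longrightarrow> smooth_on U g \<Longrightarrow> smooth_on U (\<lambda>x. f x + g x)"
  and smooth_on_bounded_linear:
    "open U \<Longrightarrow> bounded_linear L \<Longrightarrow> smooth_on U f \<Longrightarrow> smooth_on U (\<lambda>x. L (f x))"
  and smooth_on_bilinear:
    "open U \<Longrightarrow> bounded_bilinear B \<Longrightarrow> smooth_on U f' \<Longrightarrow> smooth_on U g' \<Longrightarrow> smooth_on U (\<lambda>x. B (f' x) (g' x))"
  unfolding smooth_on_def
  by (auto intro: Ck_on_const Ck_on_ident Ck_on_add Ck_on_bounded_linear Ck_on_bilinear)

lemmas smooth_on_scaleR = smooth_on_bilinear[OF _ bounded_bilinear_scaleR]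
lemmas smooth_on_mult = smooth_on_bilinear[OF _ bounded_bilinear_mult]
lemmas smooth_on_vec_nth = smooth_on_bounded_linear[OF _ bounded_linear_vec_nth]

lemma smooth_on_sum:
  "open U \<Longrightarrow> (\<And>i. i \<in> I \<Longrightarrow> smooth_on U (f i)) \<Longrightarrow> smooth_on U (\<lambda>x. \<Sum>i\<in>I. f i x)"
  unfolding smooth_on_def by (auto intro: Ck_on_sum)

lemma smooth_on_vec:
  fixes f :: "'a::real_normed_vector \<Rightarrow> real ^ 'n::finite"
  shows "open U \<Longrightarrow> (\<And>i. smooth_on U (\<lambda>x. f x $ i)) \<Longrightarrow> smooth_on U f"
  unfolding smooth_on_def by (auto intro: Ck_on_vec)

lemma smooth_on_compose:
  fixes f :: "'a::real_normed_vector \<Rightarrow> real ^ 'n::finite"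
  shows "open U \<Longrightarrow> open V \<Longrightarrow> f ` U \<subseteq> V \<Longrightarrow> smooth_on U f \<Longrightarrow> smooth_on V g \<Longrightarrow> smooth_on U (\<lambda>x. g (f x))"
  unfolding smooth_on_def by (auto intro: Ck_on_compose)

section \<open>Symmetry of second derivatives\<close>

lemma mvt_along_line:
  fixes \<phi> :: "'a::real_normed_vector \<Rightarrow> real"
  assumes s: "0 < s" and d: "\<And>t. 0 \<le> t \<Longrightarrow> t \<le> s \<Longrightarrow> (\<phi> has_derivative \<phi>' (x + t *\<^sub>R e)) (at (x + t *\<^sub>R e))"
  shows "\<exists>t. 0 < t \<and> t < s \<and> \<phi> (x + s *\<^sub>R e) - \<phi> x = s * \<phi>' (x + t *\<^sub>R e) e"
proof -
  have der: "((\<lambda>t. \<phi> (x + t *\<^sub>R e)) has_derivative (\<lambda>h. \<phi>' (x + t *\<^sub>R e) (h *\<^sub>R e))) (at t)"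
    if "0 \<le> t" "t \<le> s" for t
    by (rule has_derivative_compose[where f="\<lambda>t. x + t *\<^sub>R e", OF _ d[OF that]])
      (auto intro!: derivative_eq_intros)
  have "\<exists>t\<in>{0<..<s}. \<phi> (x + s *\<^sub>R e) - \<phi> (x + 0 *\<^sub>R e) = \<phi>' (x + t *\<^sub>R e) ((s - 0) *\<^sub>R e)"
    by (rule mvt_simple[OF s]) (use der in \<open>auto intro: has_derivative_at_withinI\<close>)
  then obtain t where t: "0 < t" "t < s" "\<phi> (x + s *\<^sub>R e) - \<phi> x = \<phi>' (x + t *\<^sub>R e) (s *\<^sub>R e)"
    by auto
  then have "\<phi>' (x + t *\<^sub>R e) (s *\<^sub>R e) = s * \<phi>' (x + t *\<^sub>R e) e"
    using linear_cmul[OF has_derivative_linear[OF d[of t]]] by simp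
  with t show ?thesis by metis
qed

text \<open>The mean value theorem is applied twice: along e to \<phi>(y + s v) - \<phi>(y), then
  along v to the derivative of \<phi> in direction e. The second difference itself does not change
  when e and v are exchanged.\<close>

lemma second_difference_mvt:
  fixes \<phi> :: "'a::real_normed_vector \<Rightarrow> real"
  assumes "Ck_on 2 \<phi> U" and s: "0 < s"
    and sub: "\<And>a b. 0 \<le> a \<Longrightarrow> a \<le> s \<Longrightarrow> 0 \<le> b \<Longrightarrow> b \<le> s \<Longrightarrow> x + a *\<^sub>R e + b *\<^sub>R v \<in> U"
  shows "\<exists>a b. 0 < a \<and> a < s \<and> 0 < b \<and> b < s \<and>
    \<phi> (x + s *\<^sub>R e + s *\<^sub>R v) - \<phi> (x + s *\<^sub>R e) - \<phi> (x + s *\<^sub>R v) + \<phi> x =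
    s * (s * frechet_derivative (\<lambda>y. frechet_derivative \<phi> (at y) e) (at (x + a *\<^sub>R e + b *\<^sub>R v)) v)"
proof -
  let ?D = "\<lambda>y. frechet_derivative \<phi> (at y)"
  have C: "\<And>x. x \<in> U \<Longrightarrow> (\<phi> has_derivative ?D x) (at x)" "Ck_on (Suc 0) (\<lambda>y. ?D y e) U"
    using assms(1) frechet_derivative_works unfolding numeral_2_eq_2 by auto
  have sub0: "x + a *\<^sub>R e \<in> U" if "0 \<le> a" "a \<le> s" for a
    using sub[OF that, of 0] s by simp
  have d: "((\<lambda>y. \<phi> (y + s *\<^sub>R v) - \<phi> y) has_derivative
      (\<lambda>w. ?D (x + a *\<^sub>R e + s *\<^sub>R v) w - ?D (x + a *\<^sub>R e) w)) (at (x + a *\<^sub>R e))"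
    if "0 \<le> a" "a \<le> s" for a
  proof (rule has_derivative_diff[OF _ C(1)[OF sub0[OF that]]])
    show "((\<lambda>y. \<phi> (y + s *\<^sub>R v)) has_derivative ?D (x + a *\<^sub>R e + s *\<^sub>R v)) (at (x + a *\<^sub>R e))"
      by (rule has_derivative_compose[where f="\<lambda>y. y + s *\<^sub>R v" and g=\<phi>, OF _ C(1)[OF sub[OF that]]])
        (use s in \<open>auto intro!: derivative_eq_intros\<close>)
  qed
  obtain a where a: "0 < a" "a < s"
    "\<phi> (x + s *\<^sub>R e + s *\<^sub>R v) - \<phi> (x + s *\<^sub>R e) - (\<phi> (x + s *\<^sub>R v) - \<phi> x) =
     s * (?D (x + a *\<^sub>R e + s *\<^sub>R v) e - ?D (x + a *\<^sub>R e) e)"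
    using mvt_along_line[where \<phi>="\<lambda>y. \<phi> (y + s *\<^sub>R v) - \<phi> y" and
       \<phi>'="\<lambda>y w. ?D (y + s *\<^sub>R v) w - ?D y w", OF s d] by auto
  obtain b where "0 < b" "b < s" "?D (x + a *\<^sub>R e + s *\<^sub>R v) e - ?D (x + a *\<^sub>R e) e =
      s * frechet_derivative (\<lambda>y. ?D y e) (at (x + a *\<^sub>R e + b *\<^sub>R v)) v"
    using mvt_along_line[where \<phi>="\<lambda>y. ?D y e" and
       \<phi>'="\<lambda>y. frechet_derivative (\<lambda>y. ?D y e) (at y)" and x="x + a *\<^sub>R e" and e=v, OF s]
      Ck_on_derivative[OF C(2)] sub[of a] a by fastforce
  with a show ?thesis by (intro exI[of _ a] exI[of _ b]) (simp add: algebra_simps)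
qed

text \<open>Evaluating the same second difference in both orders shows that the two mixed
  derivatives agree at two possibly different points of a small parallelogram. Continuity moves both
  points to x, so the values at x differ by less than any \<epsilon>.\<close>

lemma second_derivative_symmetric:
  fixes \<phi> :: "'a::real_normed_vector \<Rightarrow> real"
  assumes "open U" "Ck_on 2 \<phi> U" "x \<in> U"
  shows "frechet_derivative (\<lambda>y. frechet_derivative \<phi> (at y) e) (at x) v =
         frechet_derivative (\<lambda>y. frechet_derivative \<phi> (at y) v) (at x) e"
proof -
  let ?A = "\<lambda>p. frechet_derivative (\<lambda>y. frechet_derivative \<phi> (at y) e) (at p) v"
  let ?B = "\<lambda>p. frechet_derivative (\<lambda>y. frechet_derivative \<phi> (at y) v) (at p) e"
  have cont: "continuous_on U ?A" "continuous_on U ?B"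
    using assms(2) by (auto simp: numeral_2_eq_2)
  have "dist (?A x) (?B x) < \<epsilon>" if "\<epsilon> > 0" for \<epsilon>
  proof -
    obtain d1 where d1: "d1 > 0" "ball x d1 \<subseteq> U" using assms open_contains_ball by blast
    obtain d2 where d2: "d2 > 0" "\<And>p. p \<in> U \<Longrightarrow> dist p x < d2 \<Longrightarrow> dist (?A p) (?A x) < \<epsilon>/2"
      using cont(1) assms(3) \<open>\<epsilon> > 0\<close> unfolding continuous_on_iff by (meson half_gt_zero)
    obtain d3 where d3: "d3 > 0" "\<And>p. p \<in> U \<Longrightarrow> dist p x < d3 \<Longrightarrow> dist (?B p) (?B x) < \<epsilon>/2"
      using cont(2) assms(3) \<open>\<epsilon> > 0\<close> unfolding continuous_on_iff by (meson half_gt_zero)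
    define d where "d = min d1 (min d2 d3)"
    have d: "d > 0" "d \<le> d1" "d \<le> d2" "d \<le> d3" using d1 d2 d3 by (auto simp: d_def)
    \<comment> \<open>The summand 1 keeps \<open>K\<close> positive when both directions vanish.
      With \<open>s * K = d / 2\<close>, every point of the parallelogram stays within
      \<open>d\<close> of \<open>x\<close>.\<close>
    define K where "K = norm e + norm v + 1"
    define s where "s = d / (2 * K)"
    have pos: "K > 0" unfolding K_def by (smt (verit) norm_ge_zero)
    have s: "s > 0" unfolding s_def using d pos by simp
    have sd: "s * (norm e + norm v) < d"
    proof -
      have "s * K = d / 2" using pos by (simp add: s_def)
      then show ?thesis using s d by (simp add: K_def algebra_simps)
    qed
    have near: "dist (x + a *\<^sub>R p + b *\<^sub>R q) x < d" 
      if "0 \<le> a" "a \<le> s" "0 \<le> b" "b \<le> s" "norm p + norm q = norm e + norm v" for a b p q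
    proof -
      have "dist (x + a *\<^sub>R p + b *\<^sub>R q) x = norm (a *\<^sub>R p + b *\<^sub>R q)" by (simp add: dist_norm)
      also have "\<dots> \<le> a * norm p + b * norm q"
        using norm_triangle_ineq[of "a *\<^sub>R p" "b *\<^sub>R q"] that by simp
      also have "\<dots> \<le> s * norm p + s * norm q"
        using that by (intro add_mono mult_right_mono) auto
      finally show ?thesis using sd that(5) by (simp flip: distrib_left)
    qed
    have inU: "x + a *\<^sub>R p + b *\<^sub>R q \<in> U"
      if "0 \<le> a" "a \<le> s" "0 \<le> b" "b \<le> s" "norm p + norm q = norm e + norm v" for a b p q
      using near[OF that] d d1(2) by (auto simp: dist_commute subset_iff)
    obtain a b where ab: "0 < a" "a < s" "0 < b" "b < s"
      "\<phi> (x + s *\<^sub>R e + s *\<^sub>R v) - \<phi> (x + s *\<^sub>R e) - \<phi> (x + s *\<^sub>R v) + \<phi> x =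
        s * (s * ?A (x + a *\<^sub>R e + b *\<^sub>R v))"
      using second_difference_mvt[OF assms(2) s, of x e v] inU by blast
    have inU': "x + a *\<^sub>R v + b *\<^sub>R e \<in> U" if "0 \<le> a" "a \<le> s" "0 \<le> b" "b \<le> s" for a b
      using inU[OF that, of v e] by simp
    obtain a' b' where ab': "0 < a'" "a' < s" "0 < b'" "b' < s"
      "\<phi> (x + s *\<^sub>R v + s *\<^sub>R e) - \<phi> (x + s *\<^sub>R v) - \<phi> (x + s *\<^sub>R e) + \<phi> x =
        s * (s * ?B (x + a' *\<^sub>R v + b' *\<^sub>R e))"
      using second_difference_mvt[OF assms(2) s, of x v e] inU' by blast
    have "s * (s * ?A (x + a *\<^sub>R e + b *\<^sub>R v)) = s * (s * ?B (x + a' *\<^sub>R v + b' *\<^sub>R e))"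
      unfolding ab(5)[symmetric] ab'(5)[symmetric] by (simp add: ac_simps)
    then have eq: "?A (x + a *\<^sub>R e + b *\<^sub>R v) = ?B (x + a' *\<^sub>R v + b' *\<^sub>R e)"
      using s by simp
    have "dist (?A (x + a *\<^sub>R e + b *\<^sub>R v)) (?A x) < \<epsilon>/2"
      using ab d near[of a b e v] by (intro d2 inU) auto
    moreover have "dist (?B (x + a' *\<^sub>R v + b' *\<^sub>R e)) (?B x) < \<epsilon>/2"
      using ab' d near[of a' b' v e] by (intro d3 inU) auto
    ultimately show ?thesis
      unfolding eq by (smt (verit) dist_commute dist_triangle_half_l)
  qed
  then show ?thesis
    by (metis dist_pos_lt order_less_irrefl)
qed

section \<open>Lie derivatives of forms\<close>

lemma differential_inner:
  fixes \<phi> :: "real ^ 'n::finite \<Rightarrow> real"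
  assumes "(\<phi> has_derivative D) (at x)"
  shows "D v = differential \<phi> x \<bullet> v"
proof -
  have "D = frechet_derivative \<phi> (at x)" by (rule frechet_derivative_at[OF assms])
  then show ?thesis
    using linear_axis_expansion[OF has_derivative_linear[OF assms], of v]
    by (simp add: differential_def inner_vec_def mult.commute)
qed

lemma smooth_on_differential:
  "open U \<Longrightarrow> smooth_on U \<phi> \<Longrightarrow> smooth_on U (differential \<phi>)"
  by (rule smooth_on_vec) (simp_all add: differential_def smooth_on_frechet_derivative)

lemma smooth_on_lie_fun:
  fixes \<phi> :: "real ^ 'n::finite \<Rightarrow> 'b::real_normed_vector"
  assumes "open U" "smooth_on U v" "smooth_on U \<phi>"
  shows "smooth_on U (lie_fun v \<phi>)"
proof -
  have "smooth_on U (\<lambda>x. \<Sum>i\<in>UNIV. (v x $ i) *\<^sub>R frechet_derivative \<phi> (at x) (axis i 1))"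
    by (intro smooth_on_sum smooth_on_scaleR smooth_on_vec_nth smooth_on_frechet_derivative assms)
  moreover have "lie_fun v \<phi> x = (\<Sum>i\<in>UNIV. (v x $ i) *\<^sub>R frechet_derivative \<phi> (at x) (axis i 1))"
    if "x \<in> U" for x
    unfolding lie_fun_def
    by (rule linear_axis_expansion[OF has_derivative_linear[OF smooth_on_has_derivative[OF assms(3) that]]])
  ultimately show ?thesis by (rule smooth_on_transform[OF assms(1)])
qed

text \<open>Differentiate L_v \<phi> = <d\<phi>, v> by the product rule. The term with Dv is the
  matrix term of \<open>lie_form\<close>; in the other, v sits in one slot of the second derivative
  of \<phi>, whereas \<open>lie_form\<close> has it in the other slot, and symmetry of second
  derivatives identifies the two.\<close>

lemma lie_form_differential:
  fixes \<phi> :: "real ^ 'n::finite \<Rightarrow> real"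
  assumes U: "open U" and v: "smooth_on U v" and \<phi>: "smooth_on U \<phi>" and x: "x \<in> U"
  shows "lie_form v (differential \<phi>) x = differential (lie_fun v \<phi>) x"
proof -
  define D2 where "D2 = frechet_derivative (differential \<phi>) (at x)"
  define Dv where "Dv = frechet_derivative v (at x)"
  define H where "H i j = frechet_derivative (\<lambda>y. frechet_derivative \<phi> (at y) (axis i 1)) (at x) (axis j 1)" for i j
  have D2: "(differential \<phi> has_derivative D2) (at x)"
    unfolding D2_def by (rule smooth_on_has_derivative[OF smooth_on_differential[OF U \<phi>] x])
  have Dv: "(v has_derivative Dv) (at x)"
    unfolding Dv_def by (rule smooth_on_has_derivative[OF v x])
  have sym: "H i j = H j i" for i j
    unfolding H_def using \<phi> by (intro second_derivative_symmetric[OF U _ x]) (auto simp: smooth_on_def)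
  have D2H: "D2 w $ i = frechet_derivative (\<lambda>y. frechet_derivative \<phi> (at y) (axis i 1)) (at x) w" for w i
  proof -
    have "((\<lambda>y. differential \<phi> y $ i) has_derivative (\<lambda>w. D2 w $ i)) (at x)"
      using D2 by (rule bounded_linear.has_derivative[OF bounded_linear_vec_nth])
    from fun_cong[OF frechet_derivative_at[OF this], of w] show ?thesis
      by (simp add: differential_def)
  qed
  have "((\<lambda>y. differential \<phi> y \<bullet> v y) has_derivative
      (\<lambda>e. differential \<phi> x \<bullet> Dv e + D2 e \<bullet> v x)) (at x)"
    by (rule has_derivative_inner[OF D2 Dv])
  moreover have "differential \<phi> y \<bullet> v y = lie_fun v \<phi> y" if "y \<in> U" for y
    unfolding lie_fun_def using differential_inner[OF smooth_on_has_derivative[OF \<phi> that]] by simp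
  ultimately have "(lie_fun v \<phi> has_derivative (\<lambda>e. differential \<phi> x \<bullet> Dv e + D2 e \<bullet> v x)) (at x)"
    using has_derivative_transform_within_open[OF _ U x] by blast
  then have rhs: "frechet_derivative (lie_fun v \<phi>) (at x) = (\<lambda>e. differential \<phi> x \<bullet> Dv e + D2 e \<bullet> v x)"
    by (rule frechet_derivative_at[symmetric])
  have "D2 (v x) $ j = D2 (axis j 1) \<bullet> v x" for j
  proof -
    have "D2 (v x) $ j = (\<Sum>i\<in>UNIV. v x $ i * H j i)"
      using linear_axis_expansion[OF has_derivative_linear[OF D2], of "v x"]
      by (simp add: D2H H_def)
    also have "\<dots> = (\<Sum>i\<in>UNIV. D2 (axis j 1) $ i * v x $ i)"
      by (simp add: sym[of j] D2H) (simp add: H_def mult.commute)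
    finally show ?thesis by (simp add: inner_vec_def)
  qed
  moreover have "(differential \<phi> x v* matrix Dv) $ j = differential \<phi> x \<bullet> Dv (axis j 1)" for j
    by (simp add: vector_matrix_mult_def matrix_def inner_vec_def mult.commute)
  ultimately show ?thesis
    unfolding lie_form_def differential_def[of "lie_fun v \<phi>"] rhs D2_def[symmetric] Dv_def[symmetric]
    by (simp add: vec_eq_iff)
qed

lemma lie_form_cong:
  assumes "open U" "x \<in> U" "smooth_on U \<omega>" "\<And>y. y \<in> U \<Longrightarrow> \<omega> y = \<omega>' y"
  shows "lie_form v \<omega> x = lie_form v \<omega>' x"
proof -
  have "frechet_derivative \<omega> (at x) = frechet_derivative \<omega>' (at x)"
    using smooth_on_has_derivative[OF assms(3,2)] assms
    by (intro frechet_derivative_transform_within_open[of \<omega> x U]) (auto simp: differentiable_def)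
  then show ?thesis using assms by (simp add: lie_form_def)
qed

text \<open>Only the first summand of \<open>lie_form\<close> differentiates the coefficients; the
  matrix summand is linear over functions.\<close>

lemma lie_form_sum_scaleR:
  assumes U: "open U" and x: "x \<in> U" and I: "finite I"
    and c: "\<And>i. i \<in> I \<Longrightarrow> smooth_on U (c i)" and \<alpha>: "\<And>i. i \<in> I \<Longrightarrow> smooth_on U (\<alpha> i)"
  shows "lie_form v (\<lambda>y. \<Sum>i\<in>I. c i y *\<^sub>R \<alpha> i y) x =
    (\<Sum>i\<in>I. lie_fun v (c i) x *\<^sub>R \<alpha> i x + c i x *\<^sub>R lie_form v (\<alpha> i) x)"
proof -
  have "((\<lambda>y. \<Sum>i\<in>I. c i y *\<^sub>R \<alpha> i y) has_derivative
    (\<lambda>e. \<Sum>i\<in>I. c i x *\<^sub>R frechet_derivative (\<alpha> i) (at x) e +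
       frechet_derivative (c i) (at x) e *\<^sub>R \<alpha> i x)) (at x)"
    using smooth_on_has_derivative[OF c x] smooth_on_has_derivative[OF \<alpha> x]
    by (intro has_derivative_sum has_derivative_scaleR) auto
  then have D: "frechet_derivative (\<lambda>y. \<Sum>i\<in>I. c i y *\<^sub>R \<alpha> i y) (at x) =
    (\<lambda>e. \<Sum>i\<in>I. c i x *\<^sub>R frechet_derivative (\<alpha> i) (at x) e +
       frechet_derivative (c i) (at x) e *\<^sub>R \<alpha> i x)"
    by (rule frechet_derivative_at[symmetric])
  have M: "(\<Sum>i\<in>I. c i x *\<^sub>R \<alpha> i x) v* A = (\<Sum>i\<in>I. c i x *\<^sub>R (\<alpha> i x v* A))" for A :: "real ^ 'a ^ 'a"
    using I by (induction I)
      (simp_all add: vector_matrix_left_distrib scaleR_vector_matrix_assoc)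
  show ?thesis
    unfolding lie_form_def D M lie_fun_def
    by (simp add: sum.distrib[symmetric] algebra_simps)
qed

section \<open>Co-distributions\<close>

text \<open>Enumerating a finite index set gives the initial segment of \<open>nat\<close> that
  \<open>span_on\<close> asks for, so later proofs may index by pairs, booleans or
  intervals.\<close>

lemma span_onI:
  fixes c :: "'i \<Rightarrow> real ^ 'n::finite \<Rightarrow> real"
  assumes "finite I" "\<And>i. i \<in> I \<Longrightarrow> smooth_on U (c i)" "\<And>i. i \<in> I \<Longrightarrow> \<alpha> i \<in> S"
    and "\<And>x. x \<in> U \<Longrightarrow> \<omega> x = (\<Sum>i\<in>I. c i x *\<^sub>R \<alpha> i x)"
  shows "\<omega> \<in> span_on U S"
proof -
  obtain b where b: "bij_betw b {0..<card I} I"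
    using ex_bij_betw_nat_finite[OF assms(1)] by blast
  have "\<omega> x = (\<Sum>k<card I. c (b k) x *\<^sub>R \<alpha> (b k) x)" if "x \<in> U" for x
    using assms(4)[OF that] sum.reindex_bij_betw[OF b, of "\<lambda>i. c i x *\<^sub>R \<alpha> i x"]
    by (simp add: lessThan_atLeast0)
  moreover have "\<forall>k<card I. smooth_on U (c (b k)) \<and> \<alpha> (b k) \<in> S"
    using bij_betw_apply[OF b] assms(2,3) by auto
  ultimately show ?thesis
    unfolding span_on_def mem_Collect_eq
    by (intro exI[of _ "card I"] exI[of _ "\<lambda>k. c (b k)"] exI[of _ "\<lambda>k. \<alpha> (b k)"]) blast
qed

lemma span_onE:
  assumes "\<omega> \<in> span_on U S"
  obtains N c \<alpha> where "\<forall>i<(N::nat). smooth_on U (c i)" "\<forall>i<N. \<alpha> i \<in> S"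
    "\<forall>x\<in>U. \<omega> x = (\<Sum>i<N. c i x *\<^sub>R \<alpha> i x)"
  using assms unfolding span_on_def by blast

lemma span_on_superset: "open U \<Longrightarrow> \<alpha> \<in> S \<Longrightarrow> \<alpha> \<in> span_on U S"
  by (rule span_onI[where I="{()}" and c="\<lambda>_ _. 1" and \<alpha>="\<lambda>_. \<alpha>"]) (auto intro: smooth_on_const)

lemma span_on_cong: "\<omega> \<in> span_on U S \<Longrightarrow> (\<And>x. x \<in> U \<Longrightarrow> \<omega>' x = \<omega> x) \<Longrightarrow> \<omega>' \<in> span_on U S"
  unfolding span_on_def by auto

lemma span_on_idem:
  assumes U: "open U" and \<omega>: "\<omega> \<in> span_on U (span_on U S)"
  shows "\<omega> \<in> span_on U S"
proof -
  obtain N c \<alpha> where "\<forall>i<(N::nat). smooth_on U (c i)" "\<forall>i<N. \<alpha> i \<in> span_on U S"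
    "\<forall>x\<in>U. \<omega> x = (\<Sum>i<N. c i x *\<^sub>R \<alpha> i x)"
    using \<omega> by (rule span_onE)
  then have 1: "\<And>i. i < N \<Longrightarrow> smooth_on U (c i)" "\<And>i. i < N \<Longrightarrow> \<alpha> i \<in> span_on U S"
    "\<And>x. x \<in> U \<Longrightarrow> \<omega> x = (\<Sum>i<N. c i x *\<^sub>R \<alpha> i x)"
    by blast+
  \<comment> \<open>Length, coefficients and generators of the inner combination are packed into one
    triple, so that a single application of choice selects all three at once.\<close>
  have "\<exists>t. (\<forall>j<(fst t::nat). smooth_on U (fst (snd t) j) \<and> snd (snd t) j \<in> S) \<and>
    (\<forall>x\<in>U. \<alpha> i x = (\<Sum>j<fst t. fst (snd t) j x *\<^sub>R snd (snd t) j x))" if i: "i < N" for i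
  proof -
    obtain M d \<beta> where "\<forall>j<(M::nat). smooth_on U (d j)" "\<forall>j<M. \<beta> j \<in> S"
      "\<forall>x\<in>U. \<alpha> i x = (\<Sum>j<M. d j x *\<^sub>R \<beta> j x)"
      using 1(2)[OF i] by (rule span_onE)
    then show ?thesis by (intro exI[of _ "(M, d, \<beta>)"]) simp
  qed
  then have "\<forall>i\<in>{..<N}. \<exists>t. (\<forall>j<(fst t::nat). smooth_on U (fst (snd t) j) \<and> snd (snd t) j \<in> S) \<and>
    (\<forall>x\<in>U. \<alpha> i x = (\<Sum>j<fst t. fst (snd t) j x *\<^sub>R snd (snd t) j x))"
    by blast
  from bchoice[OF this] obtain t where t: "\<forall>i\<in>{..<N}.
      (\<forall>j<(fst (t i)::nat). smooth_on U (fst (snd (t i)) j) \<and> snd (snd (t i)) j \<in> S) \<and>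
      (\<forall>x\<in>U. \<alpha> i x = (\<Sum>j<fst (t i). fst (snd (t i)) j x *\<^sub>R snd (snd (t i)) j x))"
    by blast
  define M d \<beta> where "M i = fst (t i)" and "d i = fst (snd (t i))" and "\<beta> i = snd (snd (t i))" for i
  have 2: "(\<forall>j<M i. smooth_on U (d i j) \<and> \<beta> i j \<in> S) \<and> (\<forall>x\<in>U. \<alpha> i x = (\<Sum>j<M i. d i j x *\<^sub>R \<beta> i j x))"
    if "i < N" for i
    using bspec[OF t, of i] that by (simp add: M_def d_def \<beta>_def)
  show ?thesis
  proof (rule span_onI[where I="SIGMA i:{..<N}. {..<M i}" and c="\<lambda>(i,j) x. c i x * d i j x" and \<alpha>="\<lambda>(i,j). \<beta> i j"])
    fix x assume x: "x \<in> U"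
    have "\<omega> x = (\<Sum>i<N. \<Sum>j<M i. (c i x * d i j x) *\<^sub>R \<beta> i j x)"
      using 1(3)[OF x] 2 x by (simp add: scaleR_sum_right)
    then show "\<omega> x = (\<Sum>p\<in>(SIGMA i:{..<N}. {..<M i}). (case p of (i, j) \<Rightarrow> \<lambda>x. c i x * d i j x) x *\<^sub>R
        (case p of (i, j) \<Rightarrow> \<beta> i j) x)"
      by (simp add: sum.Sigma split_def)
  qed (use 1 2 in \<open>auto intro!: smooth_on_mult[OF U]\<close>)
qed

lemma span_on_mono_restrict:
  assumes "S \<subseteq> T" "V \<subseteq> U"
  shows "span_on U S \<subseteq> span_on V T"
proof
  fix \<omega> assume "\<omega> \<in> span_on U S"
  then obtain N c \<alpha> where "\<forall>i<(N::nat). smooth_on U (c i)" "\<forall>i<N. \<alpha> i \<in> S"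
    "\<forall>x\<in>U. \<omega> x = (\<Sum>i<N. c i x *\<^sub>R \<alpha> i x)"
    by (rule span_onE)
  then show "\<omega> \<in> span_on V T"
    using assms
    by (intro span_onI[where I="{..<N}" and c=c and \<alpha>=\<alpha>]) (auto intro: smooth_on_subset[OF _ assms(2)])
qed

lemmas span_on_mono = span_on_mono_restrict[OF _ order_refl]
lemmas span_on_restrict = span_on_mono_restrict[OF order_refl]

lemma span_on_minimal: "open U \<Longrightarrow> S \<subseteq> span_on U T \<Longrightarrow> span_on U S \<subseteq> span_on U T"
  using span_on_mono[of S "span_on U T" U] span_on_idem[of U _ T] by blast

lemma span_on_lin:
  assumes "open U" "\<alpha> \<in> span_on U S" "\<beta> \<in> span_on U S" "smooth_on U a" "smooth_on U b"
    and "\<And>x. x \<in> U \<Longrightarrow> \<omega> x = a x *\<^sub>R \<alpha> x + b x *\<^sub>R \<beta> x"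
  shows "\<omega> \<in> span_on U S"
  by (rule span_on_idem[OF assms(1)], 
      rule span_onI[where I=UNIV and c="\<lambda>t. if t then a else b" and \<alpha>="\<lambda>t. if t then \<alpha> else \<beta>"])
    (use assms in \<open>auto simp: UNIV_bool\<close>)

lemma span_on_add:
  "open U \<Longrightarrow> \<alpha> \<in> span_on U S \<Longrightarrow> \<beta> \<in> span_on U S \<Longrightarrow> (\<lambda>x. \<alpha> x + \<beta> x) \<in> span_on U S"
  by (rule span_on_lin[where a="\<lambda>_. 1" and b="\<lambda>_. 1"]) (auto intro: smooth_on_const)

lemma span_on_scale:
  "open U \<Longrightarrow> smooth_on U a \<Longrightarrow> \<alpha> \<in> span_on U S \<Longrightarrow> (\<lambda>x. a x *\<^sub>R \<alpha> x) \<in> span_on U S"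
  by (rule span_on_lin[where a=a and b="\<lambda>_. 0" and \<beta>=\<alpha>]) (auto intro: smooth_on_const)

lemma span_on_zero: "(\<lambda>x. 0) \<in> span_on U S"
  by (rule span_onI[where I="{}::nat set" and \<alpha>="undefined"]) auto

lemma span_on_sum:
  assumes "open U" "\<And>i. i \<in> I \<Longrightarrow> \<alpha> i \<in> span_on U S"
  shows "(\<lambda>x. \<Sum>i\<in>I. \<alpha> i x) \<in> span_on U S"
  using assms(2)
  by (induction I rule: infinite_finite_induct) (auto intro: span_on_zero span_on_add assms(1))

lemma smooth_on_span_on:
  assumes "open U" "\<And>\<alpha>. \<alpha> \<in> S \<Longrightarrow> smooth_on U \<alpha>" "\<omega> \<in> span_on U S"
  shows "smooth_on U \<omega>"
proof -
  obtain N c \<alpha> where "\<forall>i<(N::nat). smooth_on U (c i)" "\<forall>i<N. \<alpha> i \<in> S"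
    "\<forall>x\<in>U. \<omega> x = (\<Sum>i<N. c i x *\<^sub>R \<alpha> i x)"
    using assms(3) by (rule span_onE)
  then have 1: "\<And>i. i < N \<Longrightarrow> smooth_on U (c i)" "\<And>i. i < N \<Longrightarrow> \<alpha> i \<in> S"
    "\<And>x. x \<in> U \<Longrightarrow> \<omega> x = (\<Sum>i<N. c i x *\<^sub>R \<alpha> i x)"
    by blast+
  have "smooth_on U (\<lambda>x. \<Sum>i<N. c i x *\<^sub>R \<alpha> i x)"
    using 1 assms by (intro smooth_on_sum smooth_on_scaleR) auto
  then show ?thesis using 1(3) by (rule smooth_on_transform[OF assms(1)])
qed

text \<open>A combination in \<open>span_on\<close> may repeat generators in any order; collecting
  the coefficients of equal generators leaves one per index. This is what turns membership in a
  module into a row of the matrix \<Xi>.\<close>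

lemma span_on_finite_generators:
  fixes F :: "'i \<Rightarrow> 'n::finite field"
  assumes U: "open U" and I: "finite I" and \<omega>: "\<omega> \<in> span_on U (F ` I)"
  obtains c where "\<And>i. i \<in> I \<Longrightarrow> smooth_on U (c i)" "\<And>x. x \<in> U \<Longrightarrow> \<omega> x = (\<Sum>i\<in>I. c i x *\<^sub>R F i x)"
proof -
  obtain N c \<alpha> where "\<forall>i<(N::nat). smooth_on U (c i)" "\<forall>i<N. \<alpha> i \<in> F ` I"
    "\<forall>x\<in>U. \<omega> x = (\<Sum>i<N. c i x *\<^sub>R \<alpha> i x)"
    using \<omega> by (rule span_onE)
  then have 1: "\<And>i. i < N \<Longrightarrow> smooth_on U (c i)" "\<And>i. i < N \<Longrightarrow> \<alpha> i \<in> F ` I"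
    "\<And>x. x \<in> U \<Longrightarrow> \<omega> x = (\<Sum>i<N. c i x *\<^sub>R \<alpha> i x)"
    by blast+
  \<comment> \<open>\<open>F\<close> need not be injective, so one index is chosen for each term; an
    index that is never chosen receives an empty sum as coefficient.\<close>
  define j where "j k = (SOME i. i \<in> I \<and> \<alpha> k = F i)" for k
  have "j k \<in> I \<and> \<alpha> k = F (j k)" if "k < N" for k
    unfolding j_def by (rule someI_ex[where P="\<lambda>i. i \<in> I \<and> \<alpha> k = F i"]) (use 1(2)[OF that] in blast)
  then have j: "\<And>k. k < N \<Longrightarrow> j k \<in> I" "\<And>k. k < N \<Longrightarrow> \<alpha> k = F (j k)"
    by blast+
  define d where "d i x = (\<Sum>k\<in>{k\<in>{..<N}. j k = i}. c k x)" for i x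
  have "smooth_on U (d i)" for i
    unfolding d_def using 1 by (intro smooth_on_sum U) auto
  moreover have "\<omega> x = (\<Sum>i\<in>I. d i x *\<^sub>R F i x)" if x: "x \<in> U" for x
  proof -
    have "(\<Sum>i\<in>I. d i x *\<^sub>R F i x) = (\<Sum>i\<in>I. \<Sum>k\<in>{k\<in>{..<N}. j k = i}. c k x *\<^sub>R \<alpha> k x)"
      unfolding d_def scaleR_sum_left using j by (intro sum.cong refl) auto
    also have "\<dots> = (\<Sum>k<N. c k x *\<^sub>R \<alpha> k x)"
      using j I by (intro sum.group) auto
    finally show ?thesis using 1(3)[OF x] by simp
  qed
  ultimately show thesis by (intro that)
qed

text \<open>Constants are smooth coefficients, so every linear combination of the generators' values
  at x is the value of a form in the module. The dimension in \<open>constant_dim_near_0\<close> is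
  thus the rank of the generators at x, the same for every open set containing x.\<close>

lemma span_on_values:
  assumes "open U" "x \<in> U"
  shows "{\<omega> x | \<omega>. \<omega> \<in> span_on U S} = span ((\<lambda>\<alpha>. \<alpha> x) ` S)"
proof (intro antisym subsetI)
  fix w assume "w \<in> {\<omega> x | \<omega>. \<omega> \<in> span_on U S}"
  then obtain \<omega> where w: "w = \<omega> x" "\<omega> \<in> span_on U S" by blast
  obtain N c \<alpha> where "\<forall>i<(N::nat). smooth_on U (c i)" "\<forall>i<N. \<alpha> i \<in> S"
    "\<forall>x\<in>U. \<omega> x = (\<Sum>i<N. c i x *\<^sub>R \<alpha> i x)"
    using w(2) by (rule span_onE)
  then show "w \<in> span ((\<lambda>\<alpha>. \<alpha> x) ` S)"
    using assms(2) by (auto simp: w(1) intro!: span_sum span_scale intro: span_base)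
next
  fix w assume "w \<in> span ((\<lambda>\<alpha>. \<alpha> x) ` S)"
  then show "w \<in> {\<omega> x | \<omega>. \<omega> \<in> span_on U S}"
  proof (induction rule: span_induct_alt)
    case base
    then show ?case using span_on_zero by force
  next
    case (step c w y)
    then obtain \<alpha> \<omega> where *: "\<alpha> \<in> S" "w = \<alpha> x" "\<omega> \<in> span_on U S" "y = \<omega> x" by auto
    have "(\<lambda>z. c *\<^sub>R \<alpha> z + \<omega> z) \<in> span_on U S"
      using * assms(1) span_on_superset[OF assms(1) *(1)]
      by (intro span_on_add span_on_scale smooth_on_const)
    with * show ?case by (auto intro!: exI[of _ "\<lambda>z. c *\<^sub>R \<alpha> z + \<omega> z"])
  qed
qed

text \<open>By the Leibniz rule, differentiating a coefficient leaves its generator in place, which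
  is why \<open>S\<close> must accompany its Lie derivatives.\<close>

lemma lie_form_span_on:
  assumes U: "open U" and v: "smooth_on U v" and S: "\<And>\<alpha>. \<alpha> \<in> S \<Longrightarrow> smooth_on U \<alpha>"
    and \<omega>: "\<omega> \<in> span_on U S"
  shows "lie_form v \<omega> \<in> span_on U (S \<union> lie_form v ` S)"
proof -
  obtain N c \<alpha> where "\<forall>i<(N::nat). smooth_on U (c i)" "\<forall>i<N. \<alpha> i \<in> S"
    "\<forall>x\<in>U. \<omega> x = (\<Sum>i<N. c i x *\<^sub>R \<alpha> i x)"
    using \<omega> by (rule span_onE)
  then have 1: "\<And>i. i < N \<Longrightarrow> smooth_on U (c i)" "\<And>i. i < N \<Longrightarrow> \<alpha> i \<in> S"
    "\<And>x. x \<in> U \<Longrightarrow> \<omega> x = (\<Sum>i<N. c i x *\<^sub>R \<alpha> i x)"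
    by blast+
  let ?\<eta> = "\<lambda>x. \<Sum>i<N. lie_fun v (c i) x *\<^sub>R \<alpha> i x + c i x *\<^sub>R lie_form v (\<alpha> i) x"
  have eq: "lie_form v \<omega> x = ?\<eta> x" if x: "x \<in> U" for x
  proof -
    have "lie_form v \<omega> x = lie_form v (\<lambda>y. \<Sum>i<N. c i y *\<^sub>R \<alpha> i y) x"
      using smooth_on_span_on[OF U S \<omega>] 1(3) by (intro lie_form_cong[OF U x]) auto
    also have "\<dots> = ?\<eta> x"
      using 1 S by (intro lie_form_sum_scaleR[OF U x]) auto
    finally show ?thesis .
  qed
  have "?\<eta> \<in> span_on U (S \<union> lie_form v ` S)"
    using 1 by (intro span_on_sum span_on_add span_on_scale span_on_superset smooth_on_lie_fun U v) auto
  then show ?thesis using eq by (rule span_on_cong)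
qed

section \<open>Iterated Lie derivatives of the outputs\<close>

text \<open>No open set occurs here: the same functions serve as generators over every domain on
  which the data are smooth. Keeping the earlier stage in each step matches the summand H^k in the
  recursion for H^(k+1).\<close>

primrec observables ::
  "(real ^ 'n \<Rightarrow> real ^ 'n) set \<Rightarrow> (real ^ 'n::finite \<Rightarrow> real) set \<Rightarrow> nat \<Rightarrow> (real ^ 'n \<Rightarrow> real) set" where
  "observables X A 0 = A"
| "observables X A (Suc k) = observables X A k \<union> (\<Union>v\<in>X. lie_fun v ` observables X A k)"

lemma finite_observables: "finite X \<Longrightarrow> finite A \<Longrightarrow> finite (observables X A k)"
  by (induction k) auto

lemma observables_mono: "A \<subseteq> observables X A k"
  by (induction k) auto

lemma smooth_on_observables:
  assumes "open U" "\<And>v. v \<in> X \<Longrightarrow> smooth_on U v" "\<And>\<phi>. \<phi> \<in> A \<Longrightarrow> smooth_on U \<phi>"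
  shows "\<phi> \<in> observables X A k \<Longrightarrow> smooth_on U \<phi>"
  using assms by (induction k arbitrary: \<phi>) (auto intro: smooth_on_lie_fun)

lemma lie_form_span_observables:
  assumes U: "open U" and X: "\<And>v. v \<in> X \<Longrightarrow> smooth_on U v" and A: "\<And>\<phi>. \<phi> \<in> A \<Longrightarrow> smooth_on U \<phi>"
    and v: "v \<in> X" and \<omega>: "\<omega> \<in> span_on U (differential ` observables X A k)"
  shows "lie_form v \<omega> \<in> span_on U (differential ` observables X A (Suc k))"
proof -
  let ?D = "differential ` observables X A k"
  note sm = smooth_on_observables[OF U X A]
  have "lie_form v \<omega> \<in> span_on U (?D \<union> lie_form v ` ?D)"
    using sm by (intro lie_form_span_on[OF U X[OF v] _ \<omega>]) (auto intro: smooth_on_differential[OF U])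
  moreover have "?D \<union> lie_form v ` ?D \<subseteq> span_on U (differential ` observables X A (Suc k))"
  proof
    fix \<eta> assume "\<eta> \<in> ?D \<union> lie_form v ` ?D"
    then consider \<phi> where "\<phi> \<in> observables X A k" "\<eta> = differential \<phi>"
      | \<phi> where "\<phi> \<in> observables X A k" "\<eta> = lie_form v (differential \<phi>)" by blast
    then show "\<eta> \<in> span_on U (differential ` observables X A (Suc k))"
    proof cases
      case 1
      then show ?thesis by (intro span_on_superset[OF U]) auto
    next
      case 2
      have "differential (lie_fun v \<phi>) \<in> span_on U (differential ` observables X A (Suc k))"
        using 2 v by (intro span_on_superset[OF U]) auto
      then show ?thesis
        by (rule span_on_cong) (use 2 sm lie_form_differential[OF U X[OF v]] in auto)
    qed
  qed
  ultimately show ?thesis using span_on_minimal[OF U] by blast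
qed

text \<open>The successor stage of \<open>codist\<close> is a set of sums and not syntactically a
  span, so its closure under sums, smooth multiples and changes outside \<open>U\<close> is checked
  by hand. It then suffices to place each generator in one of the summands.\<close>

lemma codist_Suc_span_observables:
  assumes U: "open U" and X: "X = insert f (g ` {1..m})" and sX: "\<And>v. v \<in> X \<Longrightarrow> smooth_on U v"
    and A: "\<And>\<phi>. \<phi> \<in> A \<Longrightarrow> smooth_on U \<phi>"
    and H: "codist U f m g p h k = span_on U (differential ` observables X A k)"
  shows "codist U f m g p h (Suc k) = span_on U (differential ` observables X A (Suc k))"
    (is "?M = span_on U ?T")
proof (intro antisym subsetI)
  let ?H = "codist U f m g p h k"
  note codist.simps(2) [simp del]
  have HT: "?H \<subseteq> span_on U ?T"
    unfolding H by (intro span_on_mono) auto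
  have LT: "lie_codist U v ?H \<subseteq> span_on U ?T" if "v \<in> X" for v
    unfolding lie_codist_def H
    using lie_form_span_observables[OF U sX A that] by (intro span_on_minimal[OF U]) blast
  {
    fix \<omega> assume "\<omega> \<in> ?M"
    then obtain \<alpha> \<beta> \<gamma> where "\<omega> = (\<lambda>x. \<alpha> x + \<beta> x + (\<Sum>i\<in>{1..m}. \<gamma> i x))" "\<alpha> \<in> ?H"
      "\<beta> \<in> lie_codist U f ?H" "\<forall>i\<in>{1..m}. \<gamma> i \<in> lie_codist U (g i) ?H"
      unfolding codist.simps by blast
    then show "\<omega> \<in> span_on U ?T"
      using HT LT X by (auto intro!: span_on_add[OF U] span_on_sum[OF U])
  next
    have MI: "(\<lambda>x. \<alpha> x + \<beta> x + (\<Sum>i\<in>{1..m}. \<gamma> i x)) \<in> ?M" if "\<alpha> \<in> ?H"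
      "\<beta> \<in> lie_codist U f ?H" "\<And>i. i \<in> {1..m} \<Longrightarrow> \<gamma> i \<in> lie_codist U (g i) ?H" for \<alpha> \<beta> \<gamma>
      using that unfolding codist.simps by blast
    have ME: "\<exists>\<alpha> \<beta> \<gamma>. \<omega> = (\<lambda>x. \<alpha> x + \<beta> x + (\<Sum>i\<in>{1..m}. \<gamma> i x)) \<and> \<alpha> \<in> ?H \<and>
      \<beta> \<in> lie_codist U f ?H \<and> (\<forall>i\<in>{1..m}. \<gamma> i \<in> lie_codist U (g i) ?H)" if "\<omega> \<in> ?M" for \<omega>
      using that unfolding codist.simps by blast
    have zero: "(\<lambda>x. 0) \<in> ?H" "(\<lambda>x. 0) \<in> lie_codist U v ?H" for v
      unfolding H lie_codist_def by (rule span_on_zero)+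
    have cong: "\<omega>' \<in> ?M" if \<omega>: "\<omega> \<in> ?M" and eq: "\<And>x. x \<in> U \<Longrightarrow> \<omega>' x = \<omega> x" for \<omega> \<omega>'
    proof -
      obtain \<alpha> \<beta> \<gamma> where *: "\<omega> = (\<lambda>x. \<alpha> x + \<beta> x + (\<Sum>i\<in>{1..m}. \<gamma> i x))" "\<alpha> \<in> ?H"
        "\<beta> \<in> lie_codist U f ?H" "\<forall>i\<in>{1..m}. \<gamma> i \<in> lie_codist U (g i) ?H"
        using ME[OF \<omega>] by blast
      \<comment> \<open>the discrepancy outside \<open>U\<close> is absorbed by the first summand\<close>
      have "(\<lambda>x. \<alpha> x + (\<omega>' x - \<omega> x)) \<in> ?H"
        using *(2) unfolding H by (rule span_on_cong) (simp add: eq)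
      from MI[OF this *(3) bspec[OF *(4)]] show ?thesis by (simp add: *(1))
    qed
    have scale: "(\<lambda>x. c x *\<^sub>R \<omega> x) \<in> ?M" if c: "smooth_on U c" and \<omega>: "\<omega> \<in> ?M" for c \<omega>
    proof -
      obtain \<alpha> \<beta> \<gamma> where *: "\<omega> = (\<lambda>x. \<alpha> x + \<beta> x + (\<Sum>i\<in>{1..m}. \<gamma> i x))" "\<alpha> \<in> ?H"
        "\<beta> \<in> lie_codist U f ?H" "\<forall>i\<in>{1..m}. \<gamma> i \<in> lie_codist U (g i) ?H"
        using ME[OF \<omega>] by blast
      have "(\<lambda>x. c x *\<^sub>R \<alpha> x + c x *\<^sub>R \<beta> x + (\<Sum>i\<in>{1..m}. c x *\<^sub>R \<gamma> i x)) \<in> ?M"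
        using *(2-4) unfolding H lie_codist_def by (intro MI[unfolded H lie_codist_def] span_on_scale[OF U c]) auto
      then show ?thesis by (simp add: *(1) scaleR_add_right scaleR_sum_right)
    qed
    have add: "(\<lambda>x. \<omega> x + \<omega>' x) \<in> ?M" if \<omega>: "\<omega> \<in> ?M" and \<omega>': "\<omega>' \<in> ?M" for \<omega> \<omega>'
    proof -
      obtain \<alpha> \<beta> \<gamma> where *: "\<omega> = (\<lambda>x. \<alpha> x + \<beta> x + (\<Sum>i\<in>{1..m}. \<gamma> i x))" "\<alpha> \<in> ?H"
        "\<beta> \<in> lie_codist U f ?H" "\<forall>i\<in>{1..m}. \<gamma> i \<in> lie_codist U (g i) ?H"
        using ME[OF \<omega>] by blast
      obtain \<alpha>' \<beta>' \<gamma>' where **: "\<omega>' = (\<lambda>x. \<alpha>' x + \<beta>' x + (\<Sum>i\<in>{1..m}. \<gamma>' i x))" "\<alpha>' \<in> ?H"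
        "\<beta>' \<in> lie_codist U f ?H" "\<forall>i\<in>{1..m}. \<gamma>' i \<in> lie_codist U (g i) ?H"
        using ME[OF \<omega>'] by blast
      have "(\<lambda>x. (\<alpha> x + \<alpha>' x) + (\<beta> x + \<beta>' x) + (\<Sum>i\<in>{1..m}. \<gamma> i x + \<gamma>' i x)) \<in> ?M"
        using *(2-4) **(2-4) unfolding H lie_codist_def
        by (intro MI[unfolded H lie_codist_def] span_on_add[OF U]) auto
      then show ?thesis by (simp add: *(1) **(1) sum.distrib algebra_simps)
    qed
    have Lie: "differential (lie_fun v \<phi>) \<in> lie_codist U v ?H" 
      if v: "v \<in> X" and "\<phi> \<in> observables X A k" for v \<phi>
    proof -
      have "lie_form v (differential \<phi>) \<in> lie_codist U v ?H"
        using that unfolding lie_codist_def H by (intro span_on_superset[OF U] imageI) auto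
      then show ?thesis unfolding lie_codist_def
        by (rule span_on_cong)
          (use lie_form_differential[OF U sX[OF v] smooth_on_observables[OF U sX A that(2)]] in auto)
    qed
    have gen: "\<eta> \<in> ?M" if "\<eta> \<in> ?T" for \<eta>
    proof -
      from that consider \<phi> where "\<phi> \<in> observables X A k" "\<eta> = differential \<phi>"
        | \<phi> where "\<phi> \<in> observables X A k" "\<eta> = differential (lie_fun f \<phi>)"
        | \<phi> i where "\<phi> \<in> observables X A k" "i \<in> {1..m}" "\<eta> = differential (lie_fun (g i) \<phi>)"
        unfolding X by auto
      then show ?thesis
      proof cases
        case 1
        then have "\<eta> \<in> ?H" unfolding H by (intro span_on_superset[OF U]) auto
        from MI[OF this zero(2) zero(2)] show ?thesis by simp
      next
        case 2
        then have "\<eta> \<in> lie_codist U f ?H" using Lie[of f] X by auto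
        from MI[OF zero(1) this zero(2)] show ?thesis by simp
      next
        case 3
        then have "\<eta> \<in> lie_codist U (g i) ?H" using Lie[of "g i"] X by auto
        \<comment> \<open>The generator occupies the i-th summand, and the zero form fills all the
          others.\<close>
        then have "(if j = i then \<eta> else (\<lambda>x. 0)) \<in> lie_codist U (g j) ?H" for j
          using zero(2) by simp
        from MI[OF zero(1) zero(2) this] have "(\<lambda>x. \<Sum>j\<in>{1..m}. (if j = i then \<eta> else (\<lambda>x. 0)) x) \<in> ?M"
          by simp
        moreover have "(\<Sum>j\<in>{1..m}. (if j = i then \<eta> else (\<lambda>x. 0)) x) = (\<Sum>j\<in>{1..m}. if j = i then \<eta> x else 0)" for x
          by (intro sum.cong) auto
        ultimately show ?thesis using 3(2) by simp
      qed
    qed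
    fix \<omega> assume "\<omega> \<in> span_on U ?T"
    then obtain N c \<alpha> where "\<forall>i<(N::nat). smooth_on U (c i)" "\<forall>i<N. \<alpha> i \<in> ?T"
      and \<omega>: "\<forall>x\<in>U. \<omega> x = (\<Sum>i<N. c i x *\<^sub>R \<alpha> i x)"
      by (rule span_onE)
    \<comment> \<open>The closure properties of \<open>?M\<close> are binary, so the combination is
      assembled by induction on its partial sums; the bound by \<open>N\<close> keeps every term
      used within the range where it is a generator.\<close>
    then have "n \<le> N \<Longrightarrow> (\<lambda>x. \<Sum>i<n. c i x *\<^sub>R \<alpha> i x) \<in> ?M" for n
    proof (induction n)
      case 0
      from MI[OF zero(1) zero(2) zero(2)] show ?case by simp
    next
      case (Suc n)
      then have "(\<lambda>x. (\<Sum>i<n. c i x *\<^sub>R \<alpha> i x) + c n x *\<^sub>R \<alpha> n x) \<in> ?M"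
        by (intro add scale) (auto intro: gen)
      then show ?case by simp
    qed
    from cong[OF this[of N]] \<omega> show "\<omega> \<in> ?M" by simp
  }
qed

lemma codist_eq_span_observables:
  assumes U: "open U" and f: "smooth_on U f" and g: "\<And>i. i \<in> {1..m} \<Longrightarrow> smooth_on U (g i)"
    and h: "\<And>l. l \<in> {1..p} \<Longrightarrow> smooth_on U (h l)"
  shows "codist U f m g p h k =
    span_on U (differential ` observables (insert f (g ` {1..m})) (h ` {1..p}) k)"
proof (induction k)
  case 0
  show ?case by (simp add: image_image)
next
  case (Suc k)
  show ?case
    by (rule codist_Suc_span_observables[OF U refl _ _ Suc]) (use f g h in auto)
qed

section \<open>Invariance and minimality of the stationary co-distribution\<close>

text \<open>The two functions have the same derivatives at each point, so the choice made by
  \<open>frechet_derivative\<close> agrees even where there is none. This permits the normalization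
  z_j(0) = 0 without changing the span.\<close>

lemma differential_diff_const: "differential (\<lambda>x. \<phi> x - c) = differential \<phi>"
proof -
  have "((\<lambda>x. \<phi> x - c) has_derivative D) (at x) \<longleftrightarrow> (\<phi> has_derivative D) (at x)" for D x
    using has_derivative_diff[OF _ has_derivative_const[of c], of \<phi> D "at x"]
      has_derivative_add[OF _ has_derivative_const[of c], of "\<lambda>x. \<phi> x - c" D "at x"] by auto
  then show ?thesis by (simp add: differential_def frechet_derivative_def fun_eq_iff)
qed

text \<open>Each form \<open>lie_form v (differential (z i))\<close> lies in the module, and its
  coefficients with respect to the z_j form the i-th row of \<Xi>.\<close>

lemma invariant_codistI:
  assumes U: "open U" and H: "spanned_by_differentials U s z H"
    and L: "\<And>\<omega>. \<omega> \<in> H \<Longrightarrow> lie_form v \<omega> \<in> H"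
  shows "invariant_codist U v H"
proof -
  have HS: "H = span_on U ((\<lambda>j. differential (z j)) ` {1..s})"
    using H by (simp add: spanned_by_differentials_def)
  have "\<forall>i\<in>{1..s}. \<exists>c. (\<forall>j\<in>{1..s}. smooth_on U (c j)) \<and> (\<forall>x\<in>U. lie_form v (differential (z i)) x =
           (\<Sum>j\<in>{1..s}. c j x *\<^sub>R differential (z j) x))"
  proof
    fix i assume "i \<in> {1..s}"
    then have "differential (z i) \<in> H" unfolding HS by (intro span_on_superset[OF U]) auto
    from L[OF this] have "lie_form v (differential (z i)) \<in> span_on U ((\<lambda>j. differential (z j)) ` {1..s})"
      by (simp only: HS)
    from span_on_finite_generators[OF U _ this]
    show "\<exists>c. (\<forall>j\<in>{1..s}. smooth_on U (c j)) \<and> (\<forall>x\<in>U. lie_form v (differential (z i)) x =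
           (\<Sum>j\<in>{1..s}. c j x *\<^sub>R differential (z j) x))" by (metis finite_atLeastAtMost)
  qed
  from bchoice[OF this] show ?thesis
    unfolding invariant_codist_def using H by blast
qed

text \<open>The matrix \<Xi> concerns one generating family; the Leibniz rule extends closure to the
  whole module, so that invariance may be applied to any form, whatever family witnessed it.\<close>

lemma invariant_codistD:
  assumes U: "open U" and v: "smooth_on U v" and K: "invariant_codist U v K" and \<omega>: "\<omega> \<in> K"
  shows "lie_form v \<omega> \<in> K"
proof -
  obtain s z \<Xi> where z: "\<forall>j\<in>{1..s::nat}. smooth_on U (z j)"
    and KS: "K = span_on U ((\<lambda>j. differential (z j)) ` {1..s})" (is "_ = span_on U ?S")
    and \<Xi>: "\<forall>i\<in>{1..s}. \<forall>j\<in>{1..s}. smooth_on U (\<Xi> i j :: real ^ 'a \<Rightarrow> real)"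
      "\<forall>i\<in>{1..s}. \<forall>x\<in>U. lie_form v (differential (z i)) x = (\<Sum>j\<in>{1..s}. \<Xi> i j x *\<^sub>R differential (z j) x)"
    using K unfolding invariant_codist_def spanned_by_differentials_def by blast
  have "lie_form v \<omega> \<in> span_on U (?S \<union> lie_form v ` ?S)"
    using z \<omega> unfolding KS
    by (intro lie_form_span_on[OF U v]) (auto intro: smooth_on_differential[OF U])
  moreover have "lie_form v (differential (z i)) \<in> span_on U ?S" if "i \<in> {1..s}" for i
    using \<Xi> that by (intro span_onI[where I="{1..s}" and c="\<Xi> i" and \<alpha>="\<lambda>j. differential (z j)"]) auto
  then have "?S \<union> lie_form v ` ?S \<subseteq> span_on U ?S"
    using span_on_superset[OF U] by auto
  ultimately show ?thesis unfolding KS using span_on_minimal[OF U] by blast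
qed

lemma spanned_by_differentials_finite:
  assumes U: "open U" and B: "finite B" "\<And>\<phi>. \<phi> \<in> B \<Longrightarrow> smooth_on U \<phi>"
  shows "\<exists>s z. spanned_by_differentials U s z (span_on U (differential ` B)) \<and> (\<forall>j\<in>{1..s}. z j 0 = 0)"
proof -
  obtain e where e: "bij_betw e {1..card B} B"
    using ex_bij_betw_nat_finite_1[OF B(1)] by blast
  let ?z = "\<lambda>j x. e j x - e j 0"
  have "smooth_on U (\<lambda>x. e j x + - e j 0)" if "j \<in> {1..card B}" for j
    using bij_betw_apply[OF e that] by (intro smooth_on_add smooth_on_const U B)
  moreover have "(\<lambda>j. differential (?z j)) ` {1..card B} = differential ` B"
    unfolding differential_diff_const using e by (metis bij_betw_imp_surj_on image_image)
  ultimately have "spanned_by_differentials U (card B) ?z (span_on U (differential ` B))"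
    unfolding spanned_by_differentials_def by simp
  then show ?thesis by (intro exI[of _ "card B"] exI[of _ ?z]) simp
qed

text \<open>The third conclusion exports closure of the module under the Lie derivatives, the form
  in which invariance is used for the OR-system.\<close>

lemma codist_smallest:
  assumes U: "open U" and f: "smooth_on U f" and g: "\<And>i. i \<in> {1..m} \<Longrightarrow> smooth_on U (g i)"
    and h: "\<And>l. l \<in> {1..p} \<Longrightarrow> smooth_on U (h l)"
    and stable: "codist U f m g p h (Suc k) = codist U f m g p h k"
  shows "smallest_exact_invariant_containing U f m g (codist U f m g p h 0) (codist U f m g p h k)"
    and "\<exists>s z. spanned_by_differentials U s z (codist U f m g p h k) \<and> (\<forall>j\<in>{1..s}. z j 0 = 0)"
    and "\<And>v \<omega>. v \<in> insert f (g ` {1..m}) \<Longrightarrow> \<omega> \<in> codist U f m g p h k \<Longrightarrow> lie_form v \<omega> \<in> codist U f m g p h k"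
proof -
  define X where "X = insert f (g ` {1..m})"
  define A where "A = h ` {1..p}"
  have sX: "smooth_on U v" if "v \<in> X" for v using that f g by (auto simp: X_def)
  have sA: "smooth_on U \<phi>" if "\<phi> \<in> A" for \<phi> using that h by (auto simp: A_def)
  have C: "codist U f m g p h k = span_on U (differential ` observables X A k)" for k
    unfolding X_def A_def by (rule codist_eq_span_observables[OF U f g h])
  have fin: "finite (observables X A k)" 
    by (rule finite_observables) (auto simp: X_def A_def)
  show ex: "\<exists>s z. spanned_by_differentials U s z (codist U f m g p h k) \<and> (\<forall>j\<in>{1..s}. z j 0 = 0)"
    unfolding C using smooth_on_observables[OF U sX sA]
    by (intro spanned_by_differentials_finite[OF U fin]) auto
  then obtain s z where sz: "spanned_by_differentials U s z (codist U f m g p h k)" by blast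
  have inv: "lie_form v \<omega> \<in> codist U f m g p h k" if "v \<in> X" "\<omega> \<in> codist U f m g p h k" for v \<omega>
    using lie_form_span_observables[OF U sX sA that(1)] that(2) stable unfolding C by blast
  then show "\<And>v \<omega>. v \<in> insert f (g ` {1..m}) \<Longrightarrow> \<omega> \<in> codist U f m g p h k \<Longrightarrow> lie_form v \<omega> \<in> codist U f m g p h k"
    unfolding X_def by blast
  have "invariant_codist U v (codist U f m g p h k)" if "v \<in> X" for v
    using inv[OF that] by (rule invariant_codistI[OF U sz])
  moreover have "codist U f m g p h 0 \<subseteq> codist U f m g p h k"
    unfolding C using observables_mono[of A X k] by (intro span_on_mono) auto
  ultimately have "exact_invariant_containing U f m g (codist U f m g p h 0) (codist U f m g p h k)"
    unfolding exact_invariant_containing_def exact_codist_def using sz by (auto simp: X_def)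
  moreover have "codist U f m g p h k \<subseteq> K"
    if K: "exact_invariant_containing U f m g (codist U f m g p h 0) K" for K
  proof -
    obtain S where KS: "K = span_on U S"
      using K unfolding exact_invariant_containing_def exact_codist_def spanned_by_differentials_def by blast
    have K0: "codist U f m g p h 0 \<subseteq> K"
      using K unfolding exact_invariant_containing_def by blast
    have Kinv: "invariant_codist U v K" if "v \<in> X" for v
      using K that unfolding exact_invariant_containing_def X_def by blast
    \<comment> \<open>The length j is unbounded here: an invariant competitor contains the
      differentials of the iterated Lie derivatives of every length.\<close>
    have "\<phi> \<in> observables X A j \<Longrightarrow> differential \<phi> \<in> K" for \<phi> j
    proof (induction j arbitrary: \<phi>)
      case 0
      then show ?case using K0 C[of 0] span_on_superset[OF U] by fastforce
    next
      case (Suc j)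
      then consider "\<phi> \<in> observables X A j" 
        | v \<psi> where "v \<in> X" "\<psi> \<in> observables X A j" "\<phi> = lie_fun v \<psi>" by auto
      then show ?case
      proof cases
        case 1
        then show ?thesis by (rule Suc.IH)
      next
        case 2
        have "lie_form v (differential \<psi>) \<in> K"
          by (rule invariant_codistD[OF U sX[OF 2(1)] Kinv[OF 2(1)] Suc.IH[OF 2(2)]])
        \<comment> \<open>The two forms are known to agree on \<open>U\<close> only; a module given
          by \<open>span_on\<close> absorbs the difference elsewhere.\<close>
        then show ?thesis unfolding KS
          by (rule span_on_cong)
            (use 2 lie_form_differential[OF U sX[OF 2(1)] smooth_on_observables[OF U sX sA 2(2)]] in auto)
      qed
    qed
    then show ?thesis unfolding C KS by (intro span_on_minimal[OF U]) auto
  qed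
  ultimately show "smallest_exact_invariant_containing U f m g (codist U f m g p h 0) (codist U f m g p h k)"
    unfolding smallest_exact_invariant_containing_def by blast
qed

text \<open>Stationarity over \<open>V\<close> writes each generator of length at most k+1 as a
  combination of those of length at most k. The coefficients restrict to \<open>U\<close>, and the
  generators over \<open>U\<close> are the same functions.\<close>

lemma codist_stable_restrict:
  assumes V: "open V" and U: "open U" "U \<subseteq> V"
    and f: "smooth_on V f" and g: "\<And>i. i \<in> {1..m} \<Longrightarrow> smooth_on V (g i)"
    and h: "\<And>l. l \<in> {1..p} \<Longrightarrow> smooth_on V (h l)"
    and stable: "codist V f m g p h (Suc k) = codist V f m g p h k"
  shows "codist U f m g p h (Suc k) = codist U f m g p h k"
proof -
  define O' where "O' k = observables (insert f (g ` {1..m})) (h ` {1..p}) k" for k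
  have CV: "codist V f m g p h k = span_on V (differential ` O' k)" for k
    unfolding O'_def by (rule codist_eq_span_observables[OF V f g h])
  have CU: "codist U f m g p h k = span_on U (differential ` O' k)" for k
    unfolding O'_def
    by (rule codist_eq_span_observables) (use U f g h in \<open>auto intro: smooth_on_subset\<close>)
  have "differential ` O' (Suc k) \<subseteq> span_on V (differential ` O' (Suc k))"
    using span_on_superset[OF V] by (rule subsetI)
  also have "\<dots> = span_on V (differential ` O' k)"
    using stable unfolding CV .
  also have "\<dots> \<subseteq> span_on U (differential ` O' k)"
    by (rule span_on_restrict[OF U(2)])
  finally have "span_on U (differential ` O' (Suc k)) \<subseteq> span_on U (differential ` O' k)"
    by (rule span_on_minimal[OF U(1)])
  moreover have "span_on U (differential ` O' k) \<subseteq> span_on U (differential ` O' (Suc k))"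
    by (intro span_on_mono) (auto simp: O'_def)
  ultimately show ?thesis unfolding CU by blast
qed

section \<open>Inverse functions and constant rank\<close>

lemma Ck_on_det:
  fixes A :: "'a::real_normed_vector \<Rightarrow> real ^ 'n::finite ^ 'n"
  assumes "open U" "\<And>i j. Ck_on k (\<lambda>x. A x $ i $ j) U"
  shows "Ck_on k (\<lambda>x. det (A x)) U"
  unfolding det_def by (intro Ck_on_sum Ck_on_mult Ck_on_prod Ck_on_const assms)

text \<open>By Cramer's rule the solution is a quotient of determinants, which are polynomials in
  the entries.\<close>

lemma Ck_on_matrix_solve:
  fixes A :: "'a::real_normed_vector \<Rightarrow> real ^ 'n::finite ^ 'n" and b :: "real ^ 'n"
  assumes U: "open U" and A: "\<And>i j. Ck_on k (\<lambda>x. A x $ i $ j) U"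
    and nz: "\<And>x. x \<in> U \<Longrightarrow> det (A x) \<noteq> 0" and eq: "\<And>x. x \<in> U \<Longrightarrow> A x *v w x = b"
  shows "Ck_on k w U"
proof (rule Ck_on_vec[OF U])
  fix l
  let ?d = "\<lambda>x. det (\<chi> i j. if j = l then b $ i else A x $ i $ j) * inverse (det (A x))"
  have "Ck_on k (\<lambda>x. (\<chi> i j. if j = l then b $ i else A x $ i $ j) $ i $ j) U" for i j
    using A Ck_on_const[OF U] by (cases "j = l") auto
  then have "Ck_on k ?d U"
    by (intro Ck_on_mult Ck_on_inverse Ck_on_det U A nz)
  moreover have "w x $ l = ?d x" if "x \<in> U" for x
    using eq[OF that] cramer[OF nz[OF that]] by (simp add: divide_inverse)
  ultimately show "Ck_on k (\<lambda>x. w x $ l) U"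
    using Ck_on_cong[OF U, of "\<lambda>x. w x $ l" ?d k] by blast
qed

text \<open>\<open>inverse_function_theorem\<close> gives a continuous inverse G whose derivative
  DG(y)v solves the linear system with matrix DF(G(y)) and right-hand side v. If G is of class C^k,
  so is this matrix, hence by Cramer's rule the solution, hence G is of class C^(k+1). The last two
  conclusions are kept for the kernel and velocity arguments of the retraction.\<close>

lemma smooth_inverse_function:
  fixes F :: "real ^ 'n::finite \<Rightarrow> real ^ 'n"
  assumes U: "open U" and F: "smooth_on U F" and x0: "x0 \<in> U"
    and inj: "inj (frechet_derivative F (at x0))"
  obtains U' V G where "open U'" "U' \<subseteq> U" "x0 \<in> U'" "open V" "F x0 \<in> V" "homeomorphism U' V F G"
    "smooth_on V G" "\<forall>x\<in>U'. inj (frechet_derivative F (at x))"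
    "\<forall>y\<in>V. \<forall>v. frechet_derivative F (at (G y)) (frechet_derivative G (at y) v) = v"
proof -
  let ?D = "\<lambda>x. frechet_derivative F (at x)"
  define F' where "F' x = Blinfun (?D x)" for x
  have der: "(F has_derivative ?D x) (at x)" if "x \<in> U" for x
    by (rule smooth_on_has_derivative[OF F that])
  have F': "blinfun_apply (F' x) = ?D x" if "x \<in> U" for x
    unfolding F'_def using der[OF that] by (intro bounded_linear_Blinfun_apply has_derivative_bounded_linear)
  have "continuous_on U (\<lambda>x. blinfun_apply (F' x) v)" for v
    using smooth_on_continuous_on[OF smooth_on_frechet_derivative[OF F, of v]] F'
    by (simp cong: continuous_on_cong)
  then have contF': "continuous_on U F'"
    by (intro continuous_on_blinfun_componentwise)
  obtain L where L: "linear L" "L \<circ> ?D x0 = id"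
    using linear_injective_left_inverse[OF has_derivative_linear[OF der[OF x0]] inj] by blast
  have "Blinfun L o\<^sub>L F' x0 = id_blinfun"
    using L by (intro blinfun_eqI)
      (simp add: F'[OF x0] bounded_linear_Blinfun_apply linear_conv_bounded_linear pointfree_idE)
  then obtain U' V G G' where 1: "open U'" "U' \<subseteq> U" "x0 \<in> U'" "open V" "F x0 \<in> V" "homeomorphism U' V F G"
    and 2: "\<And>y. y \<in> V \<Longrightarrow> (G has_derivative (G' y)) (at y)"
    "\<And>y. y \<in> V \<Longrightarrow> G' y = inv (blinfun_apply (F' (G y)))"
    "\<And>y. y \<in> V \<Longrightarrow> bij (blinfun_apply (F' (G y)))"
    using inverse_function_theorem[OF U _ contF' x0, of F "Blinfun L"] der F' by metis
  have GU': "G y \<in> U'" if "y \<in> V" for y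
    using 1(6) that by (auto simp: homeomorphism_def)
  then have GU: "G y \<in> U" if "y \<in> V" for y
    using that 1(2) by blast
  have bij: "bij (?D (G y))" if "y \<in> V" for y
    using 2(3)[OF that] F'[OF GU[OF that]] by simp
  have inverse: "?D (G y) (G' y v) = v" if "y \<in> V" for y v
    using 2(2)[OF that] F'[OF GU[OF that]] bij[OF that] by (simp add: bij_is_surj surj_f_inv_f)
  have "Ck_on k G V" for k
  proof (induction k)
    case 0
    then show ?case using 1(6) by (auto simp: homeomorphism_def)
  next
    case (Suc k)
    have "Ck_on k (\<lambda>y. G' y v) V" for v
    proof (rule Ck_on_matrix_solve[OF 1(4)])
      fix i j
      have "smooth_on U (\<lambda>x. ?D x (axis j 1) $ i)"
        by (intro smooth_on_vec_nth smooth_on_frechet_derivative U F)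
      then have "Ck_on k (\<lambda>y. ?D (G y) (axis j 1) $ i) V"
        using GU by (intro Ck_on_compose[OF 1(4) U _ Suc.IH]) (auto simp: smooth_on_def)
      then show "Ck_on k (\<lambda>y. matrix (?D (G y)) $ i $ j) V"
        by (simp add: matrix_def)
    next
      fix y assume y: "y \<in> V"
      note lin = has_derivative_linear[OF der[OF GU[OF y]]]
      show "det (matrix (?D (G y))) \<noteq> 0"
        using det_nz_iff_inj[OF lin] bij[OF y] by (simp add: bij_is_inj)
      show "matrix (?D (G y)) *v G' y v = v"
        using inverse[OF y] by (simp add: matrix_works[where 'a=real, unfolded linear_matrix_vector_mul_eq, OF lin])
    qed
    with 2(1) show ?case by (intro Ck_on_SucI[OF 1(4)])
  qed
  then have "smooth_on V G" by (simp add: smooth_on_def)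
  moreover have "inj (?D x)" if "x \<in> U'" for x
  proof -
    have "F x \<in> V" "G (F x) = x" using 1(6) that by (auto simp: homeomorphism_def)
    then show ?thesis using bij[of "F x"] by (simp add: bij_is_inj)
  qed
  moreover have "?D (G y) (frechet_derivative G (at y) v) = v" if "y \<in> V" for y v
    using frechet_derivative_at[OF 2(1)[OF that]] inverse[OF that] by simp
  ultimately show thesis using 1 by (intro that) auto
qed

section \<open>Retraction along the level sets of a map of constant rank\<close>

text \<open>The quantifier over \<open>Y\<close> stands inside, after \<psi> and \<open>N\<close>
  are fixed, so that all Lie derivatives of Z are handled by the same retraction.\<close>

lemma constant_rank_retraction:
  fixes Z :: "real ^ 'n::finite \<Rightarrow> real ^ 's::finite"
  assumes U: "open U" "0 \<in> U" and Z: "smooth_on U Z" "Z 0 = 0"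
    and rank: "\<And>x. x \<in> U \<Longrightarrow> dim {v. frechet_derivative Z (at x) v = 0} = d"
  obtains Q \<psi> N where "open Q" "0 \<in> Q" "smooth_on Q \<psi>" "\<psi> ` Q \<subseteq> U" "open N" "0 \<in> N" "N \<subseteq> U"
    "\<forall>x\<in>N. Z x \<in> Q"
    "\<forall>Y :: real ^ 'n \<Rightarrow> real ^ 's. smooth_on U Y \<longrightarrow>
      (\<forall>x\<in>U. \<forall>v. frechet_derivative Z (at x) v = 0 \<longrightarrow> frechet_derivative Y (at x) v = 0) \<longrightarrow>
      (\<forall>x\<in>N. Y (\<psi> (Z x)) = Y x)"
proof -
  let ?D = "\<lambda>x. frechet_derivative Z (at x)"
  let ?T = "?D 0"
  have derZ: "(Z has_derivative ?D x) (at x)" if "x \<in> U" for x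
    by (rule smooth_on_has_derivative[OF Z(1) that])
  have linT: "linear ?T" by (rule has_derivative_linear[OF derZ[OF U(2)]])
  define K where "K = {v. ?T v = 0}"
  have subK: "subspace K"
    unfolding K_def by (rule linear_subspace_kernel[OF linT])
  have disj: "v = 0" if "v \<in> K" "v \<in> K\<^sup>\<bottom>" for v
    using orthogonal_Int_0[OF subK] that by blast
  have "inj_on ?T (K\<^sup>\<bottom>)"
  proof (subst linear_inj_on_iff_eq_0[OF linT subspace_orthogonal_comp], intro ballI impI)
    fix v assume "v \<in> K\<^sup>\<bottom>" "?T v = 0"
    then show "v = 0" using disj by (simp add: K_def)
  qed
  then obtain P where P: "range P \<subseteq> K\<^sup>\<bottom>" "linear P" "\<And>v. v \<in> K\<^sup>\<bottom> \<Longrightarrow> P (?T v) = v"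
    using linear_exists_left_inverse_on[OF linT subspace_orthogonal_comp] by blast
  have blP: "bounded_linear P" using P(2) by (simp add: linear_conv_bounded_linear)
  have blT: "bounded_linear ?T" using linT by (simp add: linear_conv_bounded_linear)
  define L where "L x = x - P (?T x)" for x
  have blL: "bounded_linear L"
    unfolding L_def
    by (intro bounded_linear_sub bounded_linear_ident bounded_linear_compose[OF blP blT])
  interpret L: bounded_linear L by (rule blL)
  interpret P: bounded_linear P by (rule blP)
  interpret T: bounded_linear ?T by (rule blT)
  \<comment> \<open>For x = a + b with a in \<open>K\<close> and b in
    \<open>K\<^sup>\<bottom>\<close>, P(T x) = P(T b) = b, so L x = a: \<open>L\<close> is the
    orthogonal projection onto \<open>K\<close>.\<close>
  have LK: "L x \<in> K" for x
  proof -
    have "x \<in> K + K\<^sup>\<bottom>" using subspace_sum_orthogonal_comp[OF subK] by simp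
    then obtain a b where "x = a + b" "a \<in> K" "b \<in> K\<^sup>\<bottom>" by (rule set_plus_elim)
    then show ?thesis using P(3) by (simp add: L_def T.add K_def)
  qed
  define F where "F x = P (Z x) + L x" for x
  have F: "smooth_on U F"
    unfolding F_def
    by (intro smooth_on_add U(1) smooth_on_bounded_linear[OF U(1) blP] smooth_on_bounded_linear[OF U(1) blL]
        smooth_on_ident Z(1))
  have DF: "frechet_derivative F (at x) = (\<lambda>v. P (?D x v) + L v)" if "x \<in> U" for x
  proof (rule frechet_derivative_at[symmetric])
    show "(F has_derivative (\<lambda>v. P (?D x v) + L v)) (at x)"
      unfolding F_def
      by (intro has_derivative_add bounded_linear.has_derivative[OF blP] derZ that
          bounded_linear_imp_has_derivative[OF blL])
  qed
  have "frechet_derivative F (at 0) = (\<lambda>v. v)"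
    by (simp add: DF[OF U(2)] L_def)
  then have "inj (frechet_derivative F (at 0))" by (simp add: inj_on_def)
  then obtain U' V G where G: "open U'" "U' \<subseteq> U" "0 \<in> U'" "open V" "F 0 \<in> V" "homeomorphism U' V F G"
    "smooth_on V G" "\<forall>x\<in>U'. inj (frechet_derivative F (at x))"
    "\<forall>y\<in>V. \<forall>v. frechet_derivative F (at (G y)) (frechet_derivative G (at y) v) = v"
    by (rule smooth_inverse_function[OF U(1) F U(2)])
  have F0: "F 0 = 0" by (simp add: F_def Z(2) P.zero L.zero)
  obtain r where r: "r > 0" "ball 0 r \<subseteq> V"
    using G(4,5) F0 open_contains_ball by metis
  have GU': "G y \<in> U'" if "y \<in> V" for y
    using G(6) that by (auto simp: homeomorphism_def)
  have GF: "G (F x) = x" if "x \<in> U'" for x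
    using G(6) that by (auto simp: homeomorphism_def)
  have kernel: "?D q w = 0" if q: "q \<in> U'" and w: "P (?D q w) = 0" for q w
  proof -
    have qU: "q \<in> U" using q G(2) by blast
    have linD: "linear (?D q)" by (rule has_derivative_linear[OF derZ[OF qU]])
    define E1 where "E1 = {v. ?D q v = 0}"
    define E2 where "E2 = {v. P (?D q v) = 0}"
    have sub1: "subspace E1" unfolding E1_def by (rule linear_subspace_kernel[OF linD])
    have sub2: "subspace E2" unfolding E2_def 
      using linear_subspace_kernel[OF linear_compose[OF linD P(2)]] by (simp add: o_def)
    \<comment> \<open>\<open>DF(q) = P \<circ> DZ(q) + L\<close> is injective and equals \<open>L\<close> on \<open>E2\<close>, so \<open>E2\<close> is no larger than \<open>K\<close>.\<close>
    have inj: "inj_on L E2"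
    proof (rule inj_onI)
      fix a b assume "a \<in> E2" "b \<in> E2" "L a = L b"
      then have "frechet_derivative F (at q) a = frechet_derivative F (at q) b"
        by (simp add: DF[OF qU] E2_def)
      then show "a = b" using G(8) q by (metis injD)
    qed
    have "dim E2 = dim (L ` E2)"
      using dim_image_eq[OF L.linear_axioms] inj sub2 by (metis span_eq_iff)
    also have "\<dots> \<le> dim K" using LK by (intro dim_subset) auto
    \<comment> \<open>Constancy of the rank enters here, comparing the kernel of DZ at 0 with the
      kernel at q. Together with \<open>E1 \<subseteq> E2\<close> the dimension count forces
      equality.\<close>
    also have "\<dots> = dim E1" using rank[OF U(2)] rank[OF qU] by (simp add: K_def E1_def)
    finally have "dim E2 \<le> dim E1" .
    moreover have "E1 \<subseteq> E2" by (auto simp: E1_def E2_def P.zero)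
    ultimately have "E1 = E2" using subspace_dim_equal[OF sub1 sub2] by blast
    then show ?thesis using w by (auto simp: E1_def E2_def)
  qed
  define Q where "Q = P -` ball 0 r"
  \<comment> \<open>Each condition puts one endpoint of the segment into the ball:
    \<open>Z x \<in> Q\<close> says so for P(Z(x)), and F(x) is required directly. By convexity the
    whole segment lies in the domain of \<open>G\<close>, and membership in \<open>U'\<close> gives
    G(F(x)) = x at its end.\<close>
  define N where "N = {x \<in> U'. (Z x, F x) \<in> Q \<times> ball 0 r}"
  have Q: "open Q"
    unfolding Q_def by (intro open_vimage open_ball linear_continuous_on[OF blP])
  have "open N"
  proof -
    have "continuous_on U' (\<lambda>x. (Z x, F x))"
      by (intro continuous_on_Pair continuous_on_subset[OF smooth_on_continuous_on[OF Z(1)] G(2)]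
          continuous_on_subset[OF smooth_on_continuous_on[OF F] G(2)])
    moreover have "N = U' \<inter> (\<lambda>x. (Z x, F x)) -` (Q \<times> ball 0 r)" by (auto simp: N_def)
    ultimately show ?thesis
      using continuous_open_preimage[OF _ G(1)] open_Times[OF Q open_ball] by metis
  qed
  moreover have "0 \<in> Q" using r(1) by (simp add: Q_def P.zero)
  moreover have "0 \<in> N" using G(3) F0 r(1) \<open>0 \<in> Q\<close> by (simp add: N_def Z(2))
  moreover have "N \<subseteq> U" using G(2) by (auto simp: N_def)
  moreover have "smooth_on Q (\<lambda>z. G (P z))"
    using r(2) by (intro smooth_on_compose[OF Q G(4) _ _ G(7)] 
      smooth_on_bounded_linear[OF Q blP] smooth_on_ident[OF Q]) (auto simp: Q_def)
  moreover have "(\<lambda>z. G (P z)) ` Q \<subseteq> U"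
    using r(2) GU' G(2) by (auto simp: Q_def)
  moreover have "\<forall>x\<in>N. Z x \<in> Q" by (auto simp: N_def)
  moreover have "Y (G (P (Z x))) = Y x" 
    if Y: "smooth_on U Y" "\<forall>x\<in>U. \<forall>v. ?D x v = 0 \<longrightarrow> frechet_derivative Y (at x) v = 0" and x: "x \<in> N"
    for Y :: "real ^ 'n \<Rightarrow> real ^ 's" and x
  proof -
    define y where "y t = P (Z x) + t *\<^sub>R L x" for t
    have yb: "y t \<in> ball 0 r" if "t \<in> {0..1}" for t
    proof -
      have "(1 - t) *\<^sub>R P (Z x) + t *\<^sub>R F x \<in> ball 0 r"
        using x that by (intro convexD convex_ball) (auto simp: N_def Q_def)
      then show ?thesis by (simp add: y_def F_def algebra_simps)
    qed
    have "((\<lambda>t. Y (G (y t))) has_derivative (\<lambda>h. 0)) (at t within {0..1})" if t: "t \<in> {0..1}" for t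
    proof -
      let ?w = "frechet_derivative G (at (y t)) (L x)"
      have yV: "y t \<in> V" using yb[OF t] r(2) by blast
      then have q: "G (y t) \<in> U'" "G (y t) \<in> U" using GU' G(2) by auto
      \<comment> \<open>The segment moves with velocity L x, so DF maps the velocity
        \<open>?w\<close> of the curve to L x. Solving for the P term exhibits it as a value of
        \<open>L\<close>, hence in \<open>K\<close>; as a value of \<open>P\<close> it also lies in
        \<open>K\<^sup>\<bottom>\<close>, so it is zero.\<close>
      have "P (?D (G (y t)) ?w) + L ?w = L x"
        using G(9) yV DF[OF q(2)] by metis
      then have eq: "P (?D (G (y t)) ?w) = L (x - ?w)" by (simp add: L.diff algebra_simps)
      have "P (?D (G (y t)) ?w) \<in> K" unfolding eq by (rule LK)
      then have "P (?D (G (y t)) ?w) = 0"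
        using P(1) by (intro disj) auto
      then have "?D (G (y t)) ?w = 0" by (rule kernel[OF q(1)])
      then have 0: "frechet_derivative Y (at (G (y t))) ?w = 0" using Y(2) q(2) by blast
      have dy: "(y has_derivative (\<lambda>h. h *\<^sub>R L x)) (at t)"
        unfolding y_def by (auto intro!: derivative_eq_intros)
      note dG = smooth_on_has_derivative[OF G(7) yV]
      note dY = smooth_on_has_derivative[OF Y(1) q(2)]
      have "((\<lambda>t. Y (G (y t))) has_derivative
        (\<lambda>h. frechet_derivative Y (at (G (y t))) (frechet_derivative G (at (y t)) (h *\<^sub>R L x)))) (at t)"
        by (rule has_derivative_compose[OF has_derivative_compose[OF dy dG] dY])
      then have "((\<lambda>t. Y (G (y t))) has_derivative (\<lambda>h. 0)) (at t)"
        using 0 by (simp add: linear_cmul[OF has_derivative_linear[OF dG]] linear_cmul[OF has_derivative_linear[OF dY]])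
      then show ?thesis by (rule has_derivative_at_withinI)
    qed
    then have "Y (G (y 0)) = Y (G (y 1))"
      by (intro has_derivative_zero_unique[of "{0..1}" "\<lambda>t. Y (G (y t))"]) auto
    moreover have "y 1 = F x" by (simp add: y_def F_def)
    moreover have "x \<in> U'" using x by (simp add: N_def)
    ultimately show ?thesis using GF by (simp add: y_def)
  qed
  ultimately show thesis using Q by (intro that[of Q "\<lambda>z. G (P z)" N]) auto
qed

section \<open>Exact OR-systems\<close>

lemma frechet_derivative_eq_0_iff:
  fixes Z :: "real ^ 'n::finite \<Rightarrow> real ^ 's::finite"
  assumes "smooth_on U Z" "x \<in> U"
  shows "frechet_derivative Z (at x) v = 0 \<longleftrightarrow> (\<forall>j. differential (\<lambda>x. Z x $ j) x \<bullet> v = 0)"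
proof -
  have "frechet_derivative Z (at x) v $ j = differential (\<lambda>x. Z x $ j) x \<bullet> v" for j
    by (rule differential_inner)
      (rule bounded_linear.has_derivative[OF bounded_linear_vec_nth smooth_on_has_derivative[OF assms]])
  then show ?thesis by (simp add: vec_eq_iff)
qed

lemma lie_fun_component:
  fixes Z :: "real ^ 'n::finite \<Rightarrow> real ^ 's::finite"
  assumes "smooth_on U Z" "x \<in> U"
  shows "lie_fun v Z x $ j = lie_fun v (\<lambda>x. Z x $ j) x"
proof -
  have "((\<lambda>x. Z x $ j) has_derivative (\<lambda>w. frechet_derivative Z (at x) w $ j)) (at x)"
    by (rule bounded_linear.has_derivative[OF bounded_linear_vec_nth smooth_on_has_derivative[OF assms]])
  from fun_cong[OF frechet_derivative_at[OF this], of "v x"] show ?thesis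
    by (simp add: lie_fun_def)
qed

text \<open>The annihilator of a set of covectors is the orthogonal complement of its span. This
  translates a constant dimension of the co-distribution into a constant kernel dimension of
  DZ.\<close>

lemma dim_kernel_annihilator:
  fixes S :: "(real ^ 'n::finite) set"
  assumes "K = {v. \<forall>w\<in>S. w \<bullet> v = 0}"
  shows "dim K = CARD('n) - dim S"
proof -
  have "K = {v \<in> UNIV. \<forall>w\<in>span S. orthogonal w v}"
  proof -
    have "w \<bullet> v = 0" if "v \<in> K" "w \<in> span S" for v w
      using that(2)
      by (induction rule: span_induct_alt) (use that(1) assms in \<open>auto simp: inner_add_left\<close>)
    then show ?thesis using assms by (auto simp: orthogonal_def span_base)
  qed
  then show ?thesis
    using dim_subspace_orthogonal_to_vectors[of "span S" UNIV] by simp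
qed

text \<open>For a field v of the system, the j-th component of L_v Z has differential L_v dz_j,
  which lies in \<open>H\<close> by invariance. At each point it is a combination of the dz_i and so
  vanishes on the kernel of DZ, as the retraction lemma demands of \<open>Y\<close>.\<close>

lemma exact_OR_realization_exists:
  fixes Z :: "real ^ 'n::finite \<Rightarrow> real ^ 's::finite"
  assumes U: "open U" "0 \<in> U" and Z: "output_map U H Z"
    and dim: "constant_dim_near_0 H"
    and f: "smooth_on U f" and g: "\<And>i. i \<in> {1..m} \<Longrightarrow> smooth_on U (g i)"
    and inv: "\<And>v \<omega>. v \<in> insert f (g ` {1..m}) \<Longrightarrow> \<omega> \<in> H \<Longrightarrow> lie_form v \<omega> \<in> H"
  shows "\<exists>Q \<psi>. exact_OR_realization U f m g Z Q \<psi>"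
proof -
  let ?z = "\<lambda>j x. Z x $ j"
  let ?D = "\<lambda>x. frechet_derivative Z (at x)"
  have sZ: "smooth_on U Z" "Z 0 = 0" and H: "H = span_on U (range (\<lambda>j. differential (?z j)))"
    using Z by (auto simp: output_map_def)
  obtain d O' where O': "open O'" "0 \<in> O'" "\<And>x. x \<in> O' \<Longrightarrow> dim {\<omega> x | \<omega>. \<omega> \<in> H} = d"
    using dim unfolding constant_dim_near_0_def eventually_nhds by blast
  \<comment> \<open>The retraction needs constant rank on its entire domain, so \<open>U\<close> is
    cut down to where the dimension is constant.\<close>
  define U0 where "U0 = U \<inter> O'"
  have U0: "open U0" "0 \<in> U0" "U0 \<subseteq> U" using U O' by (auto simp: U0_def)
  have sZ0: "smooth_on U0 Z" by (rule smooth_on_subset[OF sZ(1) U0(3)])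
  have vals: "{\<omega> x | \<omega>. \<omega> \<in> H} = span (range (\<lambda>j. differential (?z j) x))" if "x \<in> U" for x
    unfolding H using span_on_values[OF U(1) that] by (simp add: image_image)
  have rank: "dim {v. ?D x v = 0} = CARD('n) - d" if "x \<in> U0" for x
  proof -
    have x: "x \<in> U" "x \<in> O'" using that by (auto simp: U0_def)
    have "dim {v. ?D x v = 0} = CARD('n) - dim (range (\<lambda>j. differential (?z j) x))"
      by (rule dim_kernel_annihilator) (auto simp: frechet_derivative_eq_0_iff[OF sZ(1) x(1)])
    also have "dim (range (\<lambda>j. differential (?z j) x)) = d"
      using O'(3)[OF x(2)] unfolding vals[OF x(1)] by simp
    finally show ?thesis .
  qed
  obtain Q \<psi> N where 1: "open Q" "0 \<in> Q" "smooth_on Q \<psi>" "\<psi> ` Q \<subseteq> U0" "open N" "0 \<in> N" "N \<subseteq> U0"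
    "\<forall>x\<in>N. Z x \<in> Q" and
    2: "\<forall>Y :: real ^ 'n \<Rightarrow> real ^ 's. smooth_on U0 Y \<longrightarrow>
      (\<forall>x\<in>U0. \<forall>v. ?D x v = 0 \<longrightarrow> frechet_derivative Y (at x) v = 0) \<longrightarrow>
      (\<forall>x\<in>N. Y (\<psi> (Z x)) = Y x)"
    by (rule constant_rank_retraction[OF U0(1,2) sZ0 sZ(2) rank])
  have "lie_fun v Z (\<psi> (Z x)) = lie_fun v Z x" if v: "v \<in> insert f (g ` {1..m})" and "x \<in> N" for v x
  proof -
    have sv: "smooth_on U v" using v f g by auto
    have sz: "smooth_on U (?z j)" for j by (rule smooth_on_vec_nth[OF U(1) sZ(1)])
    have sY: "smooth_on U0 (lie_fun v Z)"
      by (rule smooth_on_subset[OF smooth_on_lie_fun[OF U(1) sv sZ(1)] U0(3)])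
    have "frechet_derivative (lie_fun v Z) (at q) w = 0" if q: "q \<in> U0" and w: "?D q w = 0" for q w
    proof -
      have qU: "q \<in> U" using q U0(3) by blast
      have "differential (\<lambda>x. lie_fun v Z x $ j) q \<bullet> w = 0" for j
      proof -
        have "smooth_on U (\<lambda>x. lie_fun v Z x $ j)"
          by (rule smooth_on_vec_nth[OF U(1) smooth_on_lie_fun[OF U(1) sv sZ(1)]])
        then have "differential (\<lambda>x. lie_fun v Z x $ j) q = differential (lie_fun v (?z j)) q"
          unfolding differential_def
          using smooth_on_has_derivative[OF _ qU] lie_fun_component[OF sZ(1)] U(1) qU
          by (subst frechet_derivative_transform_within_open[of _ q U "lie_fun v (?z j)"])
            (auto simp: differentiable_def)
        also have "\<dots> = lie_form v (differential (?z j)) q"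
          by (rule lie_form_differential[OF U(1) sv sz qU, symmetric])
        also have "\<dots> \<in> {\<omega> q | \<omega>. \<omega> \<in> H}"
          using inv[OF v] span_on_superset[OF U(1)] unfolding H by blast
        finally have "differential (\<lambda>x. lie_fun v Z x $ j) q \<in> span (range (\<lambda>j. differential (?z j) q))"
          unfolding vals[OF qU] .
        then show ?thesis
          by (induction rule: span_induct_alt)
            (use w frechet_derivative_eq_0_iff[OF sZ(1) qU] in \<open>auto simp: inner_add_left\<close>)
      qed
      then show ?thesis
        using frechet_derivative_eq_0_iff[OF sY q] by simp
    qed
    then show ?thesis using 2 sY \<open>x \<in> N\<close> by blast
  qed
  then show ?thesis
    unfolding exact_OR_realization_def using 1 U0(3)
    by (intro exI[of _ Q] exI[of _ \<psi>] conjI exI[of _ N]) auto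
qed

section \<open>Passage to smaller neighbourhoods and conclusion\<close>

text \<open>At points of \<open>U\<close> the values of both modules are the linear span of the same
  finitely many covectors.\<close>

lemma constant_dim_codist_restrict:
  assumes W: "open W" and U: "open U" "0 \<in> U" "U \<subseteq> W"
    and f: "smooth_on W f" and g: "\<And>i. i \<in> {1..m} \<Longrightarrow> smooth_on W (g i)"
    and h: "\<And>l. l \<in> {1..p} \<Longrightarrow> smooth_on W (h l)"
    and dim: "constant_dim_near_0 (codist W f m g p h k)"
  shows "constant_dim_near_0 (codist U f m g p h k)"
proof -
  let ?S = "differential ` observables (insert f (g ` {1..m})) (h ` {1..p}) k"
  have CW: "codist W f m g p h k = span_on W ?S"
    by (rule codist_eq_span_observables[OF W f g h])
  have CU: "codist U f m g p h k = span_on U ?S"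
    by (rule codist_eq_span_observables) (use U f g h in \<open>auto intro: smooth_on_subset\<close>)
  have "\<forall>\<^sub>F x in nhds 0. x \<in> U" using U by (simp add: eventually_nhds_in_open)
  then have ev: "\<forall>\<^sub>F x in nhds 0. {\<omega> x | \<omega>. \<omega> \<in> codist U f m g p h k} = {\<omega> x | \<omega>. \<omega> \<in> codist W f m g p h k}"
    by eventually_elim (use U in \<open>auto simp: CW CU span_on_values[OF W] span_on_values[OF U(1)] subset_iff\<close>)
  obtain d where "\<forall>\<^sub>F x in nhds 0. dim {\<omega> x | \<omega>. \<omega> \<in> codist W f m g p h k} = d"
    using dim unfolding constant_dim_near_0_def by blast
  with ev have "\<forall>\<^sub>F x in nhds 0. dim {\<omega> x | \<omega>. \<omega> \<in> codist U f m g p h k} = d"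
    by eventually_elim simp
  then show ?thesis unfolding constant_dim_near_0_def by blast
qed

text \<open>Locality is expressed by a \<open>V\<close> on which stationarity holds and a conclusion
  for every smaller neighbourhood \<open>U\<close>. The existence of suitable z_j is stated with a
  number s, because the target of an output map fixes its dimension as a type; the realization is
  then asserted for every output map into \<open>real ^ 's\<close>.\<close>

theorem mainTheorem8:
  fixes W :: "(real ^ 'n::finite) set"
    and f :: "real ^ 'n \<Rightarrow> real ^ 'n"
    and g :: "nat \<Rightarrow> real ^ 'n \<Rightarrow> real ^ 'n"
    and h :: "nat \<Rightarrow> real ^ 'n \<Rightarrow> real"
    and m p kstar :: nat
  assumes "open W" and "0 \<in> W"
    and "smooth_on W f"
    and "\<And>i. i \<in> {1..m} \<Longrightarrow> smooth_on W (g i)"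
    and "\<And>l. l \<in> {1..p} \<Longrightarrow> smooth_on W (h l)"
    and "\<And>l. l \<in> {1..p} \<Longrightarrow> h l 0 = 0"
    and "\<And>k. constant_dim_near_0 (codist W f m g p h k)"
    and "\<exists>V. open V \<and> 0 \<in> V \<and> V \<subseteq> W \<and>
           codist V f m g p h (Suc kstar) = codist V f m g p h kstar"
  shows "\<exists>V. open V \<and> 0 \<in> V \<and> V \<subseteq> W \<and>
    (\<forall>U. open U \<and> 0 \<in> U \<and> U \<subseteq> V \<longrightarrow>
       smallest_exact_invariant_containing U f m g (codist U f m g p h 0) (codist U f m g p h kstar) \<and>
       (\<exists>s z. spanned_by_differentials U s z (codist U f m g p h kstar) \<and> (\<forall>j\<in>{1..s}. z j 0 = 0)) \<and>
       (\<forall>Z :: real ^ 'n \<Rightarrow> real ^ 's::finite. output_map U (codist U f m g p h kstar) Z \<longrightarrow>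
          (\<exists>Q \<psi>. exact_OR_realization U f m g Z Q \<psi> \<and>
             extended_OR_system U f m g p h Q (OR_system f m g Z \<psi>))))"
proof -
  obtain V where V: "open V" "0 \<in> V" "V \<subseteq> W"
    and stable: "codist V f m g p h (Suc kstar) = codist V f m g p h kstar"
    using assms(8) by blast
  have fV: "smooth_on V f" and gV: "\<And>i. i \<in> {1..m} \<Longrightarrow> smooth_on V (g i)"
    and hV: "\<And>l. l \<in> {1..p} \<Longrightarrow> smooth_on V (h l)"
    using assms(3-5) V(3) by (auto intro: smooth_on_subset)
  show ?thesis
  proof (intro exI[of _ V] conjI V allI impI; (elim conjE)?)
    fix U assume U: "open U" "0 \<in> U" "U \<subseteq> V"
    have fU: "smooth_on U f" and gU: "\<And>i. i \<in> {1..m} \<Longrightarrow> smooth_on U (g i)"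
      and hU: "\<And>l. l \<in> {1..p} \<Longrightarrow> smooth_on U (h l)"
      using fV gV hV U(3) by (auto intro: smooth_on_subset)
    have stableU: "codist U f m g p h (Suc kstar) = codist U f m g p h kstar"
      by (rule codist_stable_restrict[OF V(1) U(1,3) fV gV hV stable])
    note * = codist_smallest[OF U(1) fU gU hU stableU]
    show smallest: "smallest_exact_invariant_containing U f m g (codist U f m g p h 0) (codist U f m g p h kstar)"
      by (rule *(1))
    show "\<exists>s z. spanned_by_differentials U s z (codist U f m g p h kstar) \<and> (\<forall>j\<in>{1..s}. z j 0 = 0)"
      by (rule *(2))
    fix Z :: "real ^ 'n \<Rightarrow> real ^ 's" assume Z: "output_map U (codist U f m g p h kstar) Z"
    have dim: "constant_dim_near_0 (codist U f m g p h kstar)"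
      using U V assms by (intro constant_dim_codist_restrict[OF assms(1) U(1,2) _ assms(3-5)]) auto
    have "\<exists>Q \<psi>. exact_OR_realization U f m g Z Q \<psi>"
      by (rule exact_OR_realization_exists[OF U(1,2) Z dim fU gU *(3)])
    then obtain Q \<psi> where "exact_OR_realization U f m g Z Q \<psi>" by blast
    \<comment> \<open>The witnesses are H^{k*} itself, the given Z and the \<psi> just found, so the
      right-hand side agrees with the OR-system by definition.\<close>
    moreover from this have "extended_OR_system U f m g p h Q (OR_system f m g Z \<psi>)"
      unfolding extended_OR_system_def using smallest Z by blast
    ultimately show "\<exists>Q \<psi>. exact_OR_realization U f m g Z Q \<psi> \<and>
             extended_OR_system U f m g p h Q (OR_system f m g Z \<psi>)" by blast
  qed
qed

end
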